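(* Let $p$ be a prime, $q=p^d$, $m\ge 1$, $H$ a subgroup of $GL_m\mathbb{F}_q$, $n\ge 1$, $x\in\mathbb{C}$, and let $\lambda$ be a partition of $n$. Let $\rho_\lambda$ be the complex Specht representation of $\Sigma_n$ attached to $\lambda$, and regard $\Sigma_n$ as the subgroup $\{(\sigma,1,\dots,1)\}$ of the wreath product $\Sigma_n\wr H$. Then \[ W^{x,H}_{n,\Sigma_n\wr H}\big(\mathrm{Ind}_{\Sigma_n}^{\Sigma_n\wr H}(\rho_\lambda)\big)=f_\lambda\big(x\,e^{2\pi\sqrt{-1}\,md/p}\big), \] where $f_\lambda(y)=\prod_{(i,j)\in[\lambda]}(y-i+j)$.
   Context: The diagram of a partition $\lambda=(\lambda_1\ge\dots\ge\lambda_r>0)$ is $[\lambda]=\{(i,j): 1\le i\le r,\ 1\le j\le\lambda_i\}$; $\rho_\lambda$ is the irreducible complex representation $S^\lambda\otimes_{\mathbb{Q}}\mathbb{C}$ of $\Sigma_n$ given by the Specht module. The wreath product $\Sigma_n\wr H$ has elements $(\sigma,\alpha_1,\dots,\alpha_n)$ with $\sigma\in\Sigma_n$, $\alpha_i\in H$, and product $(\sigma,\alpha_1,\dots,\alpha_n)(\sigma',\alpha'_1,\dots,\alpha'_n)=(\sigma\sigma',\alpha_1\alpha'_{\sigma(1)},\dots,\alpha_n\alpha'_{\sigma(n)})$, where permutations are composed so that $(\sigma\sigma')(i)=\sigma'(\sigma(i))$. For $\sigma\in\Sigma_n$ let $l(\sigma)$ be the number of cycles of $\sigma$ (fixed points counted)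 and $\psi_{n,x}(\sigma)=x^{l(\sigma)}$. For $X=(\sigma,\alpha_1,\dots,\alpha_n)$ define \[ \Lambda_{n,x,H}(X)=\prod_{\text{cycles }(x_1,\dots,x_r)\text{ of }\sigma} e^{2\pi\sqrt{-1}\,\mathrm{Tr}_{\mathbb{F}_q/\mathbb{F}_p}(\mathrm{Trace}(\alpha_{x_1}\alpha_{x_2}\cdots\alpha_{x_r}))/p}, \] the product over the cycles of $\sigma$ (including 1-cycles), each written with $\sigma(x_s)=x_{s+1}$; here $\mathrm{Trace}$ is the matrix trace on $GL_m\mathbb{F}_q$ and $\mathrm{Tr}_{\mathbb{F}_q/\mathbb{F}_p}$ the field trace. For a subgroup $J\subseteq\Sigma_n\wr H$ and a finite-dimensional complex representation $\rho$ of $J$ with character $\chi_\rho$, define \[ W^{x,H}_{n,J}(\rho)=\frac{1}{\dim_{\mathbb{C}}\rho}\sum_{X=(\sigma,\alpha_1,\dots,\alpha_n)\in J}\chi_\rho(X)\,\psi_{n,x}(\sigma)\,\Lambda_{n,x,H}(X). \] *)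

theory Defs
  imports Complex_Main "Jordan_Normal_Form.Matrix" "HOL-Combinatorics.Permutations"
    "HOL-Library.Function_Algebras"
begin

definition mat_trace :: "'a::comm_monoid_add mat \<Rightarrow> 'a" where
  "mat_trace A = (\<Sum>i<dim_row A. A $$ (i, i))"

definition is_partition :: "nat \<Rightarrow> nat list \<Rightarrow> bool" where
  "is_partition n lam \<longleftrightarrow> sorted_wrt (\<ge>) lam \<and> (\<forall>a\<in>set lam. 0 < a) \<and> sum_list lam = n"

definition young_diagram :: "nat list \<Rightarrow> (nat \<times> nat) set" where
  "young_diagram lam = {(i, j). 1 \<le> i \<and> i \<le> length lam \<and> 1 \<le> j \<and> j \<le> lam ! (i - 1)}"

definition content_poly :: "nat list \<Rightarrow> complex \<Rightarrow> complex" where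
  "content_poly lam y = (\<Prod>(i, j)\<in>young_diagram lam. y - of_nat i + of_nat j)"

text \<open>Tableaux of shape lam: bijections from the diagram to {1..n}. A tabloid is encoded by
  the function sending each k in {1..n} to the row containing k (0 outside {1..n}).
  The complex permutation module is the space of functions tabloid => complex.\<close>

type_synonym tabloid = "nat \<Rightarrow> nat"
type_synonym tvec = "tabloid \<Rightarrow> complex"

definition fscale :: "complex \<Rightarrow> tvec \<Rightarrow> tvec" where
  "fscale c f = (\<lambda>T. c * f T)"

interpretation fv: vector_space fscale
  by unfold_locales (auto simp: fscale_def fun_eq_iff algebra_simps)

definition tableaux :: "nat \<Rightarrow> nat list \<Rightarrow> (nat \<times> nat \<Rightarrow> nat) set" where
  "tableaux n lam = {t. bij_betw t (young_diagram lam) {1..n}}"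

definition tabloid_of :: "nat \<Rightarrow> nat list \<Rightarrow> (nat \<times> nat \<Rightarrow> nat) \<Rightarrow> tabloid" where
  "tabloid_of n lam t = (\<lambda>k. if k \<in> {1..n} then fst (inv_into (young_diagram lam) t k) else 0)"

definition column_stabilizer :: "nat \<Rightarrow> nat list \<Rightarrow> (nat \<times> nat \<Rightarrow> nat) \<Rightarrow> (nat \<Rightarrow> nat) set" where
  "column_stabilizer n lam t = {c. c permutes {1..n} \<and>
      (\<forall>k\<in>{1..n}. snd (inv_into (young_diagram lam) t (c k)) = snd (inv_into (young_diagram lam) t k))}"

definition polytabloid :: "nat \<Rightarrow> nat list \<Rightarrow> (nat \<times> nat \<Rightarrow> nat) \<Rightarrow> tvec" where
  "polytabloid n lam t = (\<Sum>c\<in>column_stabilizer n lam t.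
      fscale (of_int (sign c)) (\<lambda>T. if T = tabloid_of n lam (c \<circ> t) then 1 else 0))"

definition specht_space :: "nat \<Rightarrow> nat list \<Rightarrow> tvec set" where
  "specht_space n lam = fv.span (polytabloid n lam ` tableaux n lam)"

definition specht_basis :: "nat \<Rightarrow> nat list \<Rightarrow> tvec list" where
  "specht_basis n lam = (SOME bs. distinct bs \<and> fv.independent (set bs) \<and>
                                  fv.span (set bs) = specht_space n lam)"

text \<open>Permutation action on the module. With the paper's product convention
  (sigma sigma')(i) = sigma'(sigma(i)), i.e. sigma sigma' = sigma' o sigma, the map
  sigma |-> perm_action (inv sigma) is a homomorphism; here perm_action pi sends the
  basis vector of the tabloid of t to the basis vector of the tabloid of pi o t.\<close>

definition perm_action :: "(nat \<Rightarrow> nat) \<Rightarrow> tvec \<Rightarrow> tvec" where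
  "perm_action \<pi> f = (\<lambda>T. f (T \<circ> \<pi>))"

definition specht_rep :: "nat \<Rightarrow> nat list \<Rightarrow> (nat \<Rightarrow> nat) \<Rightarrow> complex mat" where
  "specht_rep n lam \<sigma> = (let bs = specht_basis n lam in
     mat (length bs) (length bs)
       (\<lambda>(i, j). fv.representation (set bs) (perm_action (Hilbert_Choice.inv \<sigma>) (bs ! j)) (bs ! i)))"

definition left_transversal ::
  "('g \<Rightarrow> 'g \<Rightarrow> 'g) \<Rightarrow> ('g \<Rightarrow> 'g) \<Rightarrow> 'g set \<Rightarrow> 'g set \<Rightarrow> 'g list" where
  "left_transversal gmult ginv G K = (SOME ts. set ts \<subseteq> G \<and>
       (\<forall>g\<in>G. \<exists>!i. i < length ts \<and> gmult (ginv (ts ! i)) g \<in> K))"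

definition induced_rep ::
  "('g \<Rightarrow> 'g \<Rightarrow> 'g) \<Rightarrow> ('g \<Rightarrow> 'g) \<Rightarrow> 'g set \<Rightarrow> 'g set \<Rightarrow> ('g \<Rightarrow> complex mat) \<Rightarrow> nat
     \<Rightarrow> 'g \<Rightarrow> complex mat" where
  "induced_rep gmult ginv G K \<rho> d g = (let ts = left_transversal gmult ginv G K in
     mat (length ts * d) (length ts * d) (\<lambda>(r, c).
       let y = gmult (gmult (ginv (ts ! (r div d))) g) (ts ! (c div d)) in
       if y \<in> K then \<rho> y $$ (r mod d, c mod d) else 0))"

definition field_trace :: "nat \<Rightarrow> nat \<Rightarrow> 'k::field \<Rightarrow> 'k" where
  "field_trace p d a = (\<Sum>i<d. a ^ (p ^ i))"

definition prime_field_val :: "'k::field \<Rightarrow> nat" where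
  "prime_field_val a = (LEAST k. of_nat k = a)"

definition add_char :: "nat \<Rightarrow> nat \<Rightarrow> 'k::field \<Rightarrow> complex" where
  "add_char p d a = exp (2 * pi * \<i> * of_nat (prime_field_val (field_trace p d a)) / of_nat p)"

type_synonym 'k wr_elem = "(nat \<Rightarrow> nat) \<times> (nat \<Rightarrow> 'k mat)"

definition is_GL_subgroup :: "nat \<Rightarrow> 'k::field mat set \<Rightarrow> bool" where
  "is_GL_subgroup m H \<longleftrightarrow> H \<subseteq> carrier_mat m m \<and> (\<forall>A\<in>H. invertible_mat A) \<and>
     1\<^sub>m m \<in> H \<and> (\<forall>A\<in>H. \<forall>B\<in>H. A * B \<in> H) \<and> (\<forall>A\<in>H. \<exists>B\<in>H. A * B = 1\<^sub>m m)"

definition wreath :: "nat \<Rightarrow> nat \<Rightarrow> 'k::field mat set \<Rightarrow> 'k wr_elem set" where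
  "wreath n m H = {(\<sigma>, \<alpha>). \<sigma> permutes {1..n} \<and> (\<forall>i\<in>{1..n}. \<alpha> i \<in> H) \<and>
                               (\<forall>i. i \<notin> {1..n} \<longrightarrow> \<alpha> i = 1\<^sub>m m)}"

definition wr_mult :: "nat \<Rightarrow> nat \<Rightarrow> 'k::field wr_elem \<Rightarrow> 'k wr_elem \<Rightarrow> 'k wr_elem" where
  "wr_mult n m X Y = (case X of (\<sigma>, \<alpha>) \<Rightarrow> case Y of (\<sigma>', \<alpha>') \<Rightarrow>
      (\<sigma>' \<circ> \<sigma>, \<lambda>i. if i \<in> {1..n} then \<alpha> i * \<alpha>' (\<sigma> i) else 1\<^sub>m m))"

definition wr_one :: "nat \<Rightarrow> 'k::field wr_elem" where
  "wr_one m = (id, \<lambda>i. 1\<^sub>m m)"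

definition wr_inv :: "nat \<Rightarrow> nat \<Rightarrow> 'k::field mat set \<Rightarrow> 'k wr_elem \<Rightarrow> 'k wr_elem" where
  "wr_inv n m H X = (THE Y. Y \<in> wreath n m H \<and> wr_mult n m X Y = wr_one m)"

definition sym_in_wreath :: "nat \<Rightarrow> nat \<Rightarrow> 'k::field wr_elem set" where
  "sym_in_wreath n m = {(\<sigma>, \<lambda>i. 1\<^sub>m m) | \<sigma>. \<sigma> permutes {1..n}}"

definition perm_orbit :: "(nat \<Rightarrow> nat) \<Rightarrow> nat \<Rightarrow> nat set" where
  "perm_orbit \<sigma> i = range (\<lambda>k. (\<sigma> ^^ k) i)"

definition perm_cycles :: "nat \<Rightarrow> (nat \<Rightarrow> nat) \<Rightarrow> nat set set" where
  "perm_cycles n \<sigma> = perm_orbit \<sigma> ` {1..n}"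

definition num_cycles :: "nat \<Rightarrow> (nat \<Rightarrow> nat) \<Rightarrow> nat" where
  "num_cycles n \<sigma> = card (perm_cycles n \<sigma>)"

definition psi :: "nat \<Rightarrow> complex \<Rightarrow> (nat \<Rightarrow> nat) \<Rightarrow> complex" where
  "psi n x \<sigma> = x ^ num_cycles n \<sigma>"

definition cycle_product :: "nat \<Rightarrow> (nat \<Rightarrow> nat) \<Rightarrow> (nat \<Rightarrow> 'k::field mat) \<Rightarrow> nat \<Rightarrow> 'k mat" where
  "cycle_product m \<sigma> \<alpha> i =
     foldr (*) (map (\<lambda>k. \<alpha> ((\<sigma> ^^ k) i)) [0..<card (perm_orbit \<sigma> i)]) (1\<^sub>m m)"

definition Lambda :: "nat \<Rightarrow> nat \<Rightarrow> nat \<Rightarrow> nat \<Rightarrow> 'k::field wr_elem \<Rightarrow> complex" where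
  "Lambda p d n m X = (case X of (\<sigma>, \<alpha>) \<Rightarrow>
     (\<Prod>C\<in>perm_cycles n \<sigma>. add_char p d (mat_trace (cycle_product m \<sigma> \<alpha> (Min C)))))"

definition W :: "nat \<Rightarrow> nat \<Rightarrow> nat \<Rightarrow> nat \<Rightarrow> complex \<Rightarrow> 'k::field wr_elem set
                 \<Rightarrow> ('k wr_elem \<Rightarrow> complex mat) \<Rightarrow> nat \<Rightarrow> complex" where
  "W p d n m x J \<rho> dr = (1 / of_nat dr) *
     (\<Sum>X\<in>J. mat_trace (\<rho> X) * psi n x (fst X) * Lambda p d n m X)"

end

theory Submission
  imports Defs "HOL-Combinatorics.Cycles" "HOL-Number_Theory.Residues"
    "Jordan_Normal_Form.Determinant"
begin

text \<open>
  Since \<open>\<psi> \<Lambda>\<close> is a class function of \<open>\<Sigma>\<^sub>n \<wr> H\<close>, summing it against an induced character amounts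
  to summing it over the subgroup. There \<open>\<Lambda>\<close> is the power \<open>\<omega> ^ l(\<sigma>)\<close> of \<open>\<omega> = exp (2 \<pi> i m d / p)\<close>,
  so with \<open>y = x \<omega>\<close> the left-hand side is the normalised trace of \<open>Z = \<Sum> y ^ l(\<sigma>) \<sigma>\<close> on the Specht
  module. The vector \<open>Z e\<^sub>t\<close> is antisymmetric under the column stabiliser \<open>C\<close> of \<open>t\<close>, and such a
  combination of tabloids is a multiple of the polytabloid \<open>e\<^sub>t\<close>; the factor is the coefficient
  \<open>\<Sum> sgn(c) y ^ l(r c)\<close> of the tabloid of \<open>t\<close>, with \<open>r\<close> in the row stabiliser and \<open>c \<in> C\<close>. Peeling off a
  corner box \<open>m\<close> of \<open>t\<close> multiplies this double sum by \<open>y - i + j\<close>: write \<open>r = r' (a m)\<close> and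
  \<open>c = (b m) c'\<close>; the terms with \<open>a \<noteq> m\<close> and \<open>b \<noteq> m\<close> cancel.
\<close>

section \<open>Cycles of a permutation\<close>

text \<open>The weights of \<open>Z\<close> are constant on conjugacy classes, so \<open>Z\<close>
  commutes with \<open>C\<close>; this is why \<open>Z\<close> passes the antisymmetry of the
  polytabloid on to its image. An antisymmetric vector vanishes at a tabloid with two entries of one
  column of \<open>t\<close> in the same row. The other tabloids of this shape differ from that of
  \<open>t\<close> by an element of \<open>C\<close>: the row indices in a column form an initial
  segment, so distinct row indices there have the least possible sum, and the total over all columns
  leaves no slack. The terms with \<open>a\<close> and \<open>b\<close> both different from the
  corner cancel because the box in the row of \<open>b\<close> and the column of \<open>a\<close>
  lies in the diagram. It supplies one row and one column transposition whose joint effect is a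
  change of sign. The basis of the Specht module and the transversal come from a choice operator, so
  the argument must not depend on them: \<open>Z\<close> acts as a scalar, and every coset
  representative contributes the same amount.\<close>

lemma perm_orbit_self [simp]: "i \<in> perm_orbit \<sigma> i"
  unfolding perm_orbit_def by (rule range_eqI[of _ _ 0]) simp

lemma perm_orbit_step: "j \<in> perm_orbit \<sigma> i \<Longrightarrow> \<sigma> j \<in> perm_orbit \<sigma> i"
  unfolding perm_orbit_def by (auto intro: range_eqI[where x = "Suc _"])

lemma perm_orbit_least:
  assumes "i \<in> S" and "\<And>j. j \<in> S \<Longrightarrow> \<sigma> j \<in> S"
  shows "perm_orbit \<sigma> i \<subseteq> S"
proof -
  have "(\<sigma> ^^ k) i \<in> S" for k
    by (induction k) (auto simp: assms)
  then show ?thesis by (auto simp: perm_orbit_def)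
qed

text \<open>Orbits are forward orbits, so symmetry rests on finite order: a positive power of
  \<open>\<sigma>\<close> fixes \<open>k\<close>, which makes \<open>k\<close> reachable from
  \<open>\<sigma> k\<close>. Hence the points from which \<open>i\<close> is reachable form a set
  closed under \<open>\<sigma>\<close>.\<close>

lemma perm_orbit_return:
  assumes "permutation \<sigma>" and "j \<in> perm_orbit \<sigma> i"
  shows "i \<in> perm_orbit \<sigma> j"
proof -
  have *: "k \<in> perm_orbit \<sigma> (\<sigma> k)" for k
  proof -
    obtain n where n: "(\<sigma> ^^ n) k = k" "n > 0"
      using permutation_self[OF assms(1)] by metis
    then obtain l where "n = Suc l" by (cases n) auto
    with n have "k = (\<sigma> ^^ l) (\<sigma> k)" by (simp add: funpow_swap1)
    then show ?thesis unfolding perm_orbit_def by blast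
  qed
  have "perm_orbit \<sigma> i \<subseteq> {k. i \<in> perm_orbit \<sigma> k}"
  proof (rule perm_orbit_least)
    fix j assume j: "j \<in> {k. i \<in> perm_orbit \<sigma> k}"
    have "perm_orbit \<sigma> j \<subseteq> perm_orbit \<sigma> (\<sigma> j)"
      by (rule perm_orbit_least) (auto intro: * perm_orbit_step)
    then show "\<sigma> j \<in> {k. i \<in> perm_orbit \<sigma> k}" using j by auto
  qed simp
  then show ?thesis using assms(2) by auto
qed

lemma perm_orbit_eq:
  assumes "permutation \<sigma>" and "j \<in> perm_orbit \<sigma> i"
  shows "perm_orbit \<sigma> j = perm_orbit \<sigma> i"
  using perm_orbit_least[OF assms(2) perm_orbit_step]
    perm_orbit_least[OF perm_orbit_return[OF assms] perm_orbit_step]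
  by (rule equalityI)

lemma perm_orbit_subset: "\<sigma> permutes A \<Longrightarrow> i \<in> A \<Longrightarrow> perm_orbit \<sigma> i \<subseteq> A"
  by (rule perm_orbit_least) (auto simp: permutes_in_image)

lemma perm_orbit_conj:
  assumes "\<And>k. \<sigma>' (\<pi> k) = \<pi> (\<sigma> k)"
  shows "perm_orbit \<sigma>' (\<pi> i) = \<pi> ` perm_orbit \<sigma> i"
proof -
  have "(\<sigma>' ^^ k) (\<pi> i) = \<pi> ((\<sigma> ^^ k) i)" for k
    by (induction k) (auto simp: assms)
  then show ?thesis by (simp add: perm_orbit_def image_image)
qed

text \<open>The set of points is a parameter because the induction over boxes removes entries and
  leaves sets other than \<open>{1..n}\<close>.\<close>

definition ncycles :: "nat set \<Rightarrow> (nat \<Rightarrow> nat) \<Rightarrow> nat" where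
  "ncycles A \<sigma> = card (perm_orbit \<sigma> ` A)"

lemma num_cycles_eq: "num_cycles n \<sigma> = ncycles {1..n} \<sigma>"
  by (simp add: num_cycles_def perm_cycles_def ncycles_def)

lemma perm_cycles_conj:
  assumes "\<pi> permutes A" and "\<And>k. \<sigma>' (\<pi> k) = \<pi> (\<sigma> k)"
  shows "perm_orbit \<sigma>' ` A = (\<lambda>C. \<pi> ` C) ` perm_orbit \<sigma> ` A"
proof -
  have "perm_orbit \<sigma>' ` A = perm_orbit \<sigma>' ` (\<pi> ` A)"
    by (simp add: permutes_image[OF assms(1)])
  also have "\<dots> = (\<lambda>C. \<pi> ` C) ` perm_orbit \<sigma> ` A"
    by (simp add: image_image perm_orbit_conj[of \<sigma>' \<pi> \<sigma>, OF assms(2)])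
  finally show ?thesis .
qed

lemma ncycles_conj:
  assumes "\<pi> permutes A" and "\<And>k. \<sigma>' (\<pi> k) = \<pi> (\<sigma> k)"
  shows "ncycles A \<sigma>' = ncycles A \<sigma>"
proof -
  have "inj (\<lambda>C. \<pi> ` C)"
    by (intro injI) (simp add: inj_image_eq_iff[OF permutes_inj[OF assms(1)]])
  then show ?thesis
    unfolding ncycles_def perm_cycles_conj[of \<pi> A \<sigma>' \<sigma>, OF assms]
    by (intro card_image) (auto intro: inj_on_subset)
qed

lemma ncycles_comp_commute:
  assumes "\<pi> permutes A"
  shows "ncycles A (\<pi> \<circ> \<tau>) = ncycles A (\<tau> \<circ> \<pi>)"
  by (rule ncycles_conj[OF assms]) simp

text \<open>A backward step stays inside a forward orbit; used for \<open>\<sigma>\<close> and for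
  its inverse, this makes the orbits equal. The Specht action goes through the inverse of
  \<open>\<sigma>\<close>, which is where this enters.\<close>

lemma ncycles_inv:
  assumes "\<sigma> permutes A" "finite A"
  shows "ncycles A (Hilbert_Choice.inv \<sigma>) = ncycles A \<sigma>"
proof -
  have p: "permutation \<sigma>" "permutation (Hilbert_Choice.inv \<sigma>)"
    using assms permutation_inverse permutes_imp_permutation by blast+
  have sub: "perm_orbit (Hilbert_Choice.inv \<tau>) i \<subseteq> perm_orbit \<tau> i" if "permutation \<tau>" for \<tau> :: "nat \<Rightarrow> nat" and i
  proof (rule perm_orbit_least)
    fix j assume "j \<in> perm_orbit \<tau> i"
    moreover have "j = \<tau> (Hilbert_Choice.inv \<tau> j)"
      by (metis bij_inv_eq_iff permutation_bijective that)
    then have "j \<in> perm_orbit \<tau> (Hilbert_Choice.inv \<tau> j)" by (metis perm_orbit_self perm_orbit_step)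
    then have "perm_orbit \<tau> j = perm_orbit \<tau> (Hilbert_Choice.inv \<tau> j)"
      by (rule perm_orbit_eq[OF that])
    moreover have "perm_orbit \<tau> j = perm_orbit \<tau> i"
      using perm_orbit_eq[OF that] \<open>j \<in> perm_orbit \<tau> i\<close> by blast
    ultimately show "Hilbert_Choice.inv \<tau> j \<in> perm_orbit \<tau> i"
      using perm_orbit_self[of "Hilbert_Choice.inv \<tau> j" \<tau>] by simp
  qed simp
  have "perm_orbit (Hilbert_Choice.inv \<sigma>) i = perm_orbit \<sigma> i" for i
    using sub[OF p(1), of i] sub[OF p(2), of i] inv_inv_eq[OF permutation_bijective[OF p(1)]]
    by (simp add: subset_antisym)
  then show ?thesis by (simp add: ncycles_def)
qed

lemma ncycles_insert_fixed:
  assumes "finite A" "m \<notin> A" "\<tau> permutes A"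
  shows "ncycles (insert m A) \<tau> = Suc (ncycles A \<tau>)"
proof -
  have "m \<notin> perm_orbit \<tau> k" if "k \<in> A" for k
    using perm_orbit_subset[OF assms(3) that] assms(2) by auto
  then have "perm_orbit \<tau> m \<notin> perm_orbit \<tau> ` A" by (metis imageE perm_orbit_self)
  then show ?thesis by (simp add: ncycles_def assms(1))
qed

text \<open>The product sends \<open>i\<close> to \<open>m\<close> and \<open>m\<close> to
  \<open>\<tau> i\<close>, so \<open>m\<close> is spliced into the cycle of \<open>i\<close>, and no
  cycle is created or merged.\<close>

lemma ncycles_insert_cycle:
  assumes "finite A" "m \<notin> A" "\<tau> permutes A" "i \<in> A"
  shows "ncycles (insert m A) (\<tau> \<circ> transpose i m) = ncycles A \<tau>"
proof -
  define s where "s = \<tau> \<circ> transpose i m"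
  have im: "i \<noteq> m" using assms by auto
  have tm: "\<tau> m = m" using assms by (simp add: permutes_not_in)
  have si: "s i = m" by (simp add: s_def tm)
  have sm: "s m = \<tau> i" by (simp add: s_def)
  have so: "s k = \<tau> k" if "k \<noteq> i" "k \<noteq> m" for k using that by (simp add: s_def transpose_def)
  have "transpose i m permutes insert m A" using assms by (intro permutes_swap_id) auto
  moreover have "\<tau> permutes insert m A" using assms(3) by (rule permutes_subset) auto
  ultimately have "s permutes insert m A" unfolding s_def by (rule permutes_compose)
  then have perm: "permutation s" using assms(1) permutes_imp_permutation by (metis finite_insert)
  define g where "g C = (if i \<in> C then insert m C else C)" for C
  have orb: "perm_orbit s k = g (perm_orbit \<tau> k)" if k: "k \<in> A" for k
  proof
    have mk: "m \<notin> perm_orbit \<tau> k"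
      using perm_orbit_subset[OF assms(3) k] assms(2) by auto
    show "perm_orbit s k \<subseteq> g (perm_orbit \<tau> k)"
    proof (rule perm_orbit_least)
      fix x assume x: "x \<in> g (perm_orbit \<tau> k)"
      consider "x = i" | "x = m" | "x \<noteq> i" "x \<noteq> m" by auto
      then show "s x \<in> g (perm_orbit \<tau> k)"
      proof cases
        case 1 then show ?thesis using x si by (auto simp: g_def im split: if_splits)
      next
        case 2 then have "i \<in> perm_orbit \<tau> k" using x mk by (auto simp: g_def split: if_splits)
        then show ?thesis using 2 sm by (auto simp: g_def perm_orbit_step)
      next
        case 3 then show ?thesis using x so[of x]
          by (simp add: g_def perm_orbit_step split: if_splits)
      qed
    qed (simp add: g_def)
    have "perm_orbit \<tau> k \<subseteq> perm_orbit s k"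
    proof (rule perm_orbit_least)
      fix x assume x: "x \<in> perm_orbit s k"
      consider "x = i" | "x = m" | "x \<noteq> i" "x \<noteq> m" by auto
      then show "\<tau> x \<in> perm_orbit s k"
      proof cases
        case 1 then show ?thesis using perm_orbit_step[OF perm_orbit_step[OF x]] by (simp add: si sm)
      next
        case 2 then show ?thesis using x tm by simp
      next
        case 3 then show ?thesis using perm_orbit_step[OF x] so[of x] by simp
      qed
    qed simp
    then show "g (perm_orbit \<tau> k) \<subseteq> perm_orbit s k"
      using si perm_orbit_step[of i s k] by (auto simp: g_def)
  qed
  have "perm_orbit s m = perm_orbit s i"
    using perm_orbit_step[OF perm_orbit_self[of i s]] by (intro perm_orbit_eq[OF perm]) (simp add: si)
  then have "perm_orbit s ` insert m A = perm_orbit s ` A" using assms(4) by auto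
  also have "\<dots> = g ` perm_orbit \<tau> ` A" by (simp add: image_image orb)
  finally have eq: "perm_orbit s ` insert m A = g ` perm_orbit \<tau> ` A" .
  have "inj_on g (perm_orbit \<tau> ` A)"
  proof (rule inj_on_inverseI[where g = "\<lambda>C. C - {m}"])
    fix C assume "C \<in> perm_orbit \<tau> ` A"
    then have "m \<notin> C" using perm_orbit_subset[OF assms(3)] assms(2) by auto
    then show "g C - {m} = C" by (auto simp: g_def)
  qed
  then show ?thesis unfolding ncycles_def s_def[symmetric] eq by (rule card_image)
qed

section \<open>Young subgroups and the cycle sum of a Young symmetrizer\<close>

text \<open>One notion for both stabilisers of a tableau: row labels give the row stabiliser, column
  labels the column stabiliser.\<close>

definition young_subgroup :: "nat set \<Rightarrow> (nat \<Rightarrow> 'b) \<Rightarrow> (nat \<Rightarrow> nat) set" where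
  "young_subgroup A f = {s. s permutes A \<and> (\<forall>k\<in>A. f (s k) = f k)}"

lemma young_subgroup_permutes: "s \<in> young_subgroup A f \<Longrightarrow> s permutes A"
  by (simp add: young_subgroup_def)

lemma young_subgroup_label: "s \<in> young_subgroup A f \<Longrightarrow> f (s k) = f k"
  by (cases "k \<in> A") (auto simp: young_subgroup_def permutes_not_in)

lemma id_in_young_subgroup: "id \<in> young_subgroup A f"
  by (simp add: young_subgroup_def)

lemma young_subgroup_comp:
  "s \<in> young_subgroup A f \<Longrightarrow> t \<in> young_subgroup A f \<Longrightarrow> s \<circ> t \<in> young_subgroup A f"
  using young_subgroup_label[of s A f] young_subgroup_label[of t A f]
  by (auto simp: young_subgroup_def intro: permutes_compose)

lemma young_subgroup_inv:
  assumes "s \<in> young_subgroup A f"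
  shows "Hilbert_Choice.inv s \<in> young_subgroup A f"
proof -
  have p: "s permutes A" using assms by (rule young_subgroup_permutes)
  have "f (Hilbert_Choice.inv s k) = f k" for k
    using young_subgroup_label[OF assms, of "Hilbert_Choice.inv s k"] permutes_inverses(1)[OF p] by simp
  then show ?thesis using permutes_inv[OF p] by (simp add: young_subgroup_def)
qed

lemma transpose_in_young_subgroup:
  "i \<in> A \<Longrightarrow> j \<in> A \<Longrightarrow> f i = f j \<Longrightarrow> transpose i j \<in> young_subgroup A f"
  by (auto simp: young_subgroup_def permutes_swap_id transpose_def)

lemma finite_young_subgroup: "finite A \<Longrightarrow> finite (young_subgroup A f)"
  by (rule finite_subset[OF _ finite_permutations[of A]]) (auto simp: young_subgroup_def)

lemma sum_young_subgroup_inv: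
  "(\<Sum>s\<in>young_subgroup A f. g (Hilbert_Choice.inv s)) = (\<Sum>s\<in>young_subgroup A f. g s)"
  by (rule sum.reindex_bij_witness[where i = Hilbert_Choice.inv and j = Hilbert_Choice.inv])
     (auto intro: young_subgroup_inv simp: permutes_inv_inv[OF young_subgroup_permutes])

lemma sum_young_subgroup_right:
  assumes "t \<in> young_subgroup A f"
  shows "(\<Sum>s\<in>young_subgroup A f. g (s \<circ> t)) = (\<Sum>s\<in>young_subgroup A f. g s)"
  using permutes_inv_o[OF young_subgroup_permutes[OF assms]]
  by (intro sum.reindex_bij_witness[where i = "\<lambda>s. s \<circ> Hilbert_Choice.inv t" and j = "\<lambda>s. s \<circ> t"])
     (auto intro: young_subgroup_comp young_subgroup_inv assms simp: o_assoc[symmetric])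

lemma sum_young_subgroup_left:
  assumes "t \<in> young_subgroup A f"
  shows "(\<Sum>s\<in>young_subgroup A f. g (t \<circ> s)) = (\<Sum>s\<in>young_subgroup A f. g s)"
  using permutes_inv_o[OF young_subgroup_permutes[OF assms]]
  by (intro sum.reindex_bij_witness[where i = "\<lambda>s. Hilbert_Choice.inv t \<circ> s" and j = "\<lambda>s. t \<circ> s"])
     (auto intro: young_subgroup_comp young_subgroup_inv assms simp: o_assoc)

text \<open>Coset decomposition by the preimage \<open>i\<close> of \<open>m\<close>: composing
  \<open>s\<close> on the right with the transposition of \<open>i\<close> and \<open>m\<close>
  gives a permutation fixing \<open>m\<close>, and \<open>i\<close> has the label of
  \<open>m\<close> because \<open>s\<close> preserves labels.\<close>

lemma sum_young_subgroup_insert_right: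
  assumes "m \<notin> A" "finite A"
  shows "(\<Sum>s\<in>young_subgroup (insert m A) f. g s) =
         (\<Sum>i | i \<in> insert m A \<and> f i = f m. \<Sum>s\<in>young_subgroup A f. g (s \<circ> transpose i m))"
proof -
  let ?B = "insert m A" and ?I = "{i. i \<in> insert m A \<and> f i = f m}"
  have sub: "s \<in> young_subgroup ?B f" if "s \<in> young_subgroup A f" for s
    using that young_subgroup_label[OF that] permutes_subset[of s A ?B]
    by (auto simp: young_subgroup_def)
  have fixes_m: "s m = m" if "s \<in> young_subgroup A f" for s
    using young_subgroup_permutes[OF that] assms by (simp add: permutes_not_in)
  have "(\<Sum>i\<in>?I. \<Sum>s\<in>young_subgroup A f. g (s \<circ> transpose i m)) =
        (\<Sum>(i, s)\<in>?I \<times> young_subgroup A f. g (s \<circ> transpose i m))"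
    by (rule sum.cartesian_product)
  also have "\<dots> = (\<Sum>s\<in>young_subgroup ?B f. g s)"
  proof (rule sum.reindex_bij_witness[where
        i = "\<lambda>s. (Hilbert_Choice.inv s m, s \<circ> transpose (Hilbert_Choice.inv s m) m)" and
        j = "\<lambda>(i, s). s \<circ> transpose i m"])
    fix x assume x: "x \<in> ?I \<times> young_subgroup A f"
    obtain i s where xis: "x = (i, s)" by (cases x)
    then have i: "i \<in> ?I" and s: "s \<in> young_subgroup A f" using x by auto
    have t: "transpose i m \<in> young_subgroup ?B f"
      using i by (intro transpose_in_young_subgroup) auto
    have st: "s \<circ> transpose i m \<in> young_subgroup ?B f"
      using young_subgroup_comp[OF sub[OF s] t] .
    then show "(case x of (i, s) \<Rightarrow> s \<circ> transpose i m) \<in> young_subgroup ?B f"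
      by (simp add: xis)
    have "(s \<circ> transpose i m) i = m" using fixes_m[OF s] by simp
    then have "Hilbert_Choice.inv (s \<circ> transpose i m) m = i"
      using permutes_inv_eq[OF young_subgroup_permutes[OF st]] by blast
    then show "(Hilbert_Choice.inv (case x of (i, s) \<Rightarrow> s \<circ> transpose i m) m,
          (case x of (i, s) \<Rightarrow> s \<circ> transpose i m) \<circ>
             transpose (Hilbert_Choice.inv (case x of (i, s) \<Rightarrow> s \<circ> transpose i m) m) m) = x"
      by (simp add: xis o_assoc[symmetric])
    show "g (case x of (i, s) \<Rightarrow> s \<circ> transpose i m) = (case x of (i, s) \<Rightarrow> g (s \<circ> transpose i m))"
      by (simp add: xis)
  next
    fix s assume s: "s \<in> young_subgroup ?B f"
    let ?i = "Hilbert_Choice.inv s m"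
    have "?i \<in> ?I"
      using permutes_in_image[OF young_subgroup_permutes[OF young_subgroup_inv[OF s]], of m]
        young_subgroup_label[OF young_subgroup_inv[OF s], of m] by auto
    then have t: "transpose ?i m \<in> young_subgroup ?B f"
      by (intro transpose_in_young_subgroup) auto
    have st: "s \<circ> transpose ?i m \<in> young_subgroup ?B f" by (rule young_subgroup_comp[OF s t])
    have "(s \<circ> transpose ?i m) m = m"
      using permutes_inverses(1)[OF young_subgroup_permutes[OF s]] by simp
    then have "s \<circ> transpose ?i m permutes A"
      using assms by (intro permutes_superset[OF young_subgroup_permutes[OF st]]) auto
    then have "s \<circ> transpose ?i m \<in> young_subgroup A f"
      using young_subgroup_label[OF st] by (simp add: young_subgroup_def)
    then show "(?i, s \<circ> transpose ?i m) \<in> ?I \<times> young_subgroup A f"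
      using \<open>?i \<in> ?I\<close> by blast
    show "(case (?i, s \<circ> transpose ?i m) of (i, s) \<Rightarrow> s \<circ> transpose i m) = s"
      by (simp add: o_assoc[symmetric])
  qed
  finally show ?thesis by simp
qed

text \<open>Inversion permutes the group and exchanges left and right cosets.\<close>

lemma sum_young_subgroup_insert_left:
  assumes "m \<notin> A" "finite A"
  shows "(\<Sum>s\<in>young_subgroup (insert m A) f. g s) =
         (\<Sum>i | i \<in> insert m A \<and> f i = f m. \<Sum>s\<in>young_subgroup A f. g (transpose i m \<circ> s))"
proof -
  have "(\<Sum>s\<in>young_subgroup (insert m A) f. g s) =
        (\<Sum>s\<in>young_subgroup (insert m A) f. g (Hilbert_Choice.inv s))"
    by (rule sum_young_subgroup_inv[symmetric])
  also have "\<dots> = (\<Sum>i | i \<in> insert m A \<and> f i = f m.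
      \<Sum>s\<in>young_subgroup A f. g (Hilbert_Choice.inv (s \<circ> transpose i m)))"
    by (rule sum_young_subgroup_insert_right[OF assms])
  also have "\<dots> = (\<Sum>i | i \<in> insert m A \<and> f i = f m.
      \<Sum>s\<in>young_subgroup A f. g (transpose i m \<circ> Hilbert_Choice.inv s))"
    by (intro sum.cong refl)
       (simp add: o_inv_distrib permutes_bij[OF young_subgroup_permutes])
  also have "\<dots> = (\<Sum>i | i \<in> insert m A \<and> f i = f m.
      \<Sum>s\<in>young_subgroup A f. g (transpose i m \<circ> s))"
    by (intro sum.cong refl sum_young_subgroup_inv)
  finally show ?thesis .
qed

text \<open>The sum is sent to its negative by \<open>r \<mapsto> r (j k)\<close>, \<open>c \<mapsto> (i k) c\<close>.\<close>

lemma sum_row_col_transpose_eq_0: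
  fixes h :: "(nat \<Rightarrow> nat) \<Rightarrow> complex"
  assumes "finite A" "i \<in> A" "j \<in> A" "k \<in> A" "rw j = rw k" "cl i = cl k"
    and "i \<noteq> j" "i \<noteq> k" "j \<noteq> k"
  shows "(\<Sum>r\<in>young_subgroup A rw. \<Sum>c\<in>young_subgroup A cl.
            of_int (sign c) * h (r \<circ> transpose i j \<circ> c)) = 0"
    (is "?S = 0")
proof -
  have jk: "transpose j k \<in> young_subgroup A rw" and ik: "transpose i k \<in> young_subgroup A cl"
    using assms by (auto intro: transpose_in_young_subgroup)
  \<comment> \<open>Hence the two substitutions together leave the argument of \<open>h\<close>
    alone, and only the sign of \<open>c\<close> changes.\<close>
  have braid: "transpose j k \<circ> transpose i j \<circ> transpose i k = transpose i j"
    using assms by (auto simp: transpose_def fun_eq_iff)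
  have "?S = (\<Sum>r\<in>young_subgroup A rw. \<Sum>c\<in>young_subgroup A cl.
            of_int (sign (transpose i k \<circ> c)) *
              h (r \<circ> transpose j k \<circ> transpose i j \<circ> (transpose i k \<circ> c)))"
    unfolding sum_young_subgroup_left[OF ik,
        where g = "\<lambda>c. of_int (sign c) * h (r \<circ> transpose j k \<circ> transpose i j \<circ> c)" for r]
    by (rule sum_young_subgroup_right[OF jk, symmetric])
  also have "\<dots> = (\<Sum>r\<in>young_subgroup A rw. \<Sum>c\<in>young_subgroup A cl.
            - (of_int (sign c) * h (r \<circ> transpose i j \<circ> c)))"
  proof (intro sum.cong refl)
    fix r c :: "nat \<Rightarrow> nat" assume "c \<in> young_subgroup A cl"
    then have "permutation c"
      using assms(1) young_subgroup_permutes permutes_imp_permutation by blast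
    then have "sign (transpose i k \<circ> c) = - sign c"
      using assms by (simp add: sign_compose permutation_swap_id sign_swap_id)
    moreover have "r \<circ> transpose j k \<circ> transpose i j \<circ> (transpose i k \<circ> c) = r \<circ> transpose i j \<circ> c"
      using braid by (metis o_assoc)
    ultimately show "of_int (sign (transpose i k \<circ> c)) *
              h (r \<circ> transpose j k \<circ> transpose i j \<circ> (transpose i k \<circ> c)) =
            - (of_int (sign c) * h (r \<circ> transpose i j \<circ> c))" by simp
  qed
  also have "\<dots> = - ?S" by (simp add: sum_negf)
  finally show ?thesis by simp
qed

text \<open>A tableau is encoded by the coordinates \<open>rw k\<close>, \<open>cl k\<close> of the box with entry
  \<open>k\<close>, so that removing a box only shrinks the set of entries.\<close>

definition young_shape :: "nat set \<Rightarrow> (nat \<Rightarrow> nat) \<Rightarrow> (nat \<Rightarrow> nat) \<Rightarrow> bool" where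
  "young_shape A rw cl \<longleftrightarrow> finite A \<and> inj_on (\<lambda>k. (rw k, cl k)) A \<and>
     (\<forall>k\<in>A. 1 \<le> rw k \<and> 1 \<le> cl k) \<and>
     (\<forall>k\<in>A. \<forall>i\<in>{1..rw k}. \<forall>j\<in>{1..cl k}. \<exists>l\<in>A. rw l = i \<and> cl l = j)"

lemma young_shapeI:
  assumes "finite A" and "\<And>k. k \<in> A \<Longrightarrow> 1 \<le> rw k" and "\<And>k. k \<in> A \<Longrightarrow> 1 \<le> cl k"
    and "\<And>k l. k \<in> A \<Longrightarrow> l \<in> A \<Longrightarrow> rw k = rw l \<Longrightarrow> cl k = cl l \<Longrightarrow> k = l"
    and "\<And>k i j. k \<in> A \<Longrightarrow> 1 \<le> i \<Longrightarrow> i \<le> rw k \<Longrightarrow> 1 \<le> j \<Longrightarrow> j \<le> cl k \<Longrightarrow>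
           \<exists>l\<in>A. rw l = i \<and> cl l = j"
  shows "young_shape A rw cl"
  unfolding young_shape_def inj_on_def using assms by (intro conjI ballI impI) auto

lemma young_shape_finite: "young_shape A rw cl \<Longrightarrow> finite A"
  by (simp add: young_shape_def)

lemma young_shape_pos:
  assumes "young_shape A rw cl" "k \<in> A"
  shows "1 \<le> rw k" and "1 \<le> cl k"
  using assms unfolding young_shape_def by blast+

lemma young_shape_inj:
  "young_shape A rw cl \<Longrightarrow> k \<in> A \<Longrightarrow> l \<in> A \<Longrightarrow> rw k = rw l \<Longrightarrow> cl k = cl l \<Longrightarrow> k = l"
  unfolding young_shape_def inj_on_def by blast

lemma young_shape_box:
  assumes "young_shape A rw cl" "k \<in> A" "1 \<le> i" "i \<le> rw k" "1 \<le> j" "j \<le> cl k"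
  obtains l where "l \<in> A" "rw l = i" "cl l = j"
  using assms unfolding young_shape_def by (meson atLeastAtMost_iff)

lemma young_shape_swap:
  assumes "young_shape A rw cl"
  shows "young_shape A cl rw"
proof (rule young_shapeI)
  fix k i j assume "k \<in> A" "1 \<le> i" "i \<le> cl k" "1 \<le> j" "j \<le> rw k"
  then show "\<exists>l\<in>A. cl l = i \<and> rw l = j"
    using young_shape_box[OF assms, of k j i] by metis
qed (use young_shape_finite[OF assms] young_shape_pos[OF assms] young_shape_inj[OF assms] in blast)+

text \<open>Maximality of \<open>rw m + cl m\<close> makes \<open>m\<close> the last box of its row,
  and a shape has no gaps to the left of \<open>m\<close>, so the companions correspond to the
  columns before \<open>cl m\<close>.\<close>

lemma card_row_companions:
  assumes ys: "young_shape A rw cl" and m: "m \<in> A"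
    and max: "\<And>k. k \<in> A \<Longrightarrow> rw k + cl k \<le> rw m + cl m"
  shows "card {i \<in> A - {m}. rw i = rw m} = cl m - 1"
proof -
  note inj = young_shape_inj[OF ys]
  have "bij_betw cl {i \<in> A - {m}. rw i = rw m} {1..<cl m}"
    unfolding bij_betw_def
  proof
    show "inj_on cl {i \<in> A - {m}. rw i = rw m}"
      by (rule inj_onI) (auto intro: inj)
    show "cl ` {i \<in> A - {m}. rw i = rw m} = {1..<cl m}"
    proof
      show "cl ` {i \<in> A - {m}. rw i = rw m} \<subseteq> {1..<cl m}"
      proof clarsimp
        fix i assume i: "i \<in> A" "i \<noteq> m" "rw i = rw m"
        then have "cl i \<noteq> cl m" "cl i \<le> cl m" using inj[of i m] m max[of i] by auto
        moreover have "1 \<le> cl i" using young_shape_pos[OF ys] i by blast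
        ultimately show "Suc 0 \<le> cl i \<and> cl i < cl m" by auto
      qed
      show "{1..<cl m} \<subseteq> cl ` {i \<in> A - {m}. rw i = rw m}"
      proof
        fix j assume j: "j \<in> {1..<cl m}"
        obtain l where "l \<in> A" "rw l = rw m" "cl l = j"
          using young_shape_box[OF ys m, of "rw m" j] young_shape_pos[OF ys m] j by auto
        then show "j \<in> cl ` {i \<in> A - {m}. rw i = rw m}" using j by auto
      qed
    qed
  qed
  then show ?thesis by (simp add: bij_betw_same_card)
qed

text \<open>The sum is compared with that of the shape without \<open>m\<close>. Trivial cosets on
  both sides leave \<open>m\<close> as an extra cycle and give \<open>y\<close>; each of the
  \<open>rw m - 1\<close> other boxes in the column of \<open>m\<close> gives -1 through the sign;
  each of the \<open>cl m - 1\<close> other boxes in its row gives 1. The two shifts by 1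
  cancel.\<close>

lemma young_symmetrizer_cycle_sum:
  fixes y :: complex
  assumes "young_shape A rw cl"
  shows "(\<Sum>r\<in>young_subgroup A rw. \<Sum>c\<in>young_subgroup A cl.
            of_int (sign c) * y ^ ncycles A (r \<circ> c)) =
         (\<Prod>k\<in>A. y - of_nat (rw k) + of_nat (cl k))"
  using assms
proof (induction "card A" arbitrary: A)
  case 0
  then have "A = {}" by (simp add: young_shape_def)
  moreover have "young_subgroup {} f = {id}" for f :: "nat \<Rightarrow> nat"
    by (auto simp: young_subgroup_def)
  ultimately show ?case by (simp add: ncycles_def)
next
  case (Suc N)
  define S where "S B = (\<Sum>r\<in>young_subgroup B rw. \<Sum>c\<in>young_subgroup B cl.
            of_int (sign c) * y ^ ncycles B (r \<circ> c))" for B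
  note ys = Suc.prems
  have fin: "finite A" by (rule young_shape_finite[OF ys])
  \<comment> \<open>A box with the largest \<open>rw + cl\<close> has nothing to its right or below
    it, so deleting it leaves a Young shape.\<close>
  have "Max ((\<lambda>k. rw k + cl k) ` A) \<in> (\<lambda>k. rw k + cl k) ` A"
    using fin Suc.hyps by (intro Max_in) auto
  then obtain m where m: "m \<in> A" "Max ((\<lambda>k. rw k + cl k) ` A) = rw m + cl m" by auto
  have max: "rw k + cl k \<le> rw m + cl m" if "k \<in> A" for k
    unfolding m(2)[symmetric] using fin that by (intro Max_ge) auto
  note inj = young_shape_inj[OF ys] and pos = young_shape_pos[OF ys]
  define B where "B = A - {m}"
  have A: "A = insert m B" and mB: "m \<notin> B" and finB: "finite B"
    using m fin by (auto simp: B_def)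
  have "young_shape B rw cl"
  proof (rule young_shapeI)
    fix k i j assume kij: "k \<in> B" "1 \<le> i" "i \<le> rw k" "1 \<le> j" "j \<le> cl k"
    then have k: "k \<in> A" "k \<noteq> m" by (auto simp: B_def)
    obtain l where l: "l \<in> A" "rw l = i" "cl l = j"
      using young_shape_box[OF ys k(1) kij(2-5)] by blast
    have "l \<noteq> m"
    proof
      assume "l = m"
      then have "rw m \<le> rw k" "cl m \<le> cl k" using l kij by auto
      then have "rw k = rw m" "cl k = cl m" using max[OF k(1)] by linarith+
      then show False using inj[OF k(1) m(1)] k by blast
    qed
    then show "\<exists>l\<in>B. rw l = i \<and> cl l = j" using l by (auto simp: B_def)
  qed (use finB pos inj in \<open>auto simp: B_def\<close>)
  moreover have "N = card B" using Suc.hyps(2) m fin by (simp add: B_def)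
  ultimately have IH: "S B = (\<Prod>k\<in>B. y - of_nat (rw k) + of_nat (cl k))"
    unfolding S_def using Suc.hyps(1) by blast
  define R where "R = {i \<in> B. rw i = rw m}"
  define C where "C = {j \<in> B. cl j = cl m}"
  have cardR: "card R = cl m - 1"
    using card_row_companions[OF ys m(1) max] by (simp add: R_def B_def)
  have cardC: "card C = rw m - 1"
    using card_row_companions[OF young_shape_swap[OF ys] m(1)] max
    by (simp add: C_def B_def add.commute)
  have finRC: "finite R" "finite C" using finB by (auto simp: R_def C_def)
  have mRC: "m \<notin> R" "m \<notin> C" using mB by (auto simp: R_def C_def)
  \<comment> \<open>\<open>T i j\<close> collects the pairs in one coset on each side; an index
    equal to \<open>m\<close> stands for the trivial coset.\<close>
  define T where "T i j = (\<Sum>r\<in>young_subgroup B rw. \<Sum>c\<in>young_subgroup B cl.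
      of_int (sign (transpose j m \<circ> c)) * y ^ ncycles A (r \<circ> transpose i m \<circ> (transpose j m \<circ> c)))"
    for i j
  have "S A = (\<Sum>i\<in>insert m R. \<Sum>r\<in>young_subgroup B rw. \<Sum>j\<in>insert m C. \<Sum>c\<in>young_subgroup B cl.
      of_int (sign (transpose j m \<circ> c)) * y ^ ncycles A (r \<circ> transpose i m \<circ> (transpose j m \<circ> c)))"
  proof -
    have *: "{i. i \<in> insert m B \<and> rw i = rw m} = insert m R"
      "{i. i \<in> insert m B \<and> cl i = cl m} = insert m C"
      by (auto simp: R_def C_def)
    have "S A = (\<Sum>i\<in>insert m R. \<Sum>r\<in>young_subgroup B rw. \<Sum>c\<in>young_subgroup A cl.
        of_int (sign c) * y ^ ncycles A (r \<circ> transpose i m \<circ> c))"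
      unfolding S_def using sum_young_subgroup_insert_right[OF mB finB, where f = rw and
          g = "\<lambda>r. \<Sum>c\<in>young_subgroup A cl. of_int (sign c) * y ^ ncycles A (r \<circ> c)"] unfolding * A by simp
    moreover have "(\<Sum>c\<in>young_subgroup A cl. g c) =
        (\<Sum>j\<in>insert m C. \<Sum>c\<in>young_subgroup B cl. g (transpose j m \<circ> c))" for g :: "_ \<Rightarrow> complex"
      using sum_young_subgroup_insert_left[OF mB finB, where f = cl and g = g] unfolding * A by simp
    ultimately show ?thesis by simp
  qed
  also have "\<dots> = (\<Sum>i\<in>insert m R. \<Sum>j\<in>insert m C. T i j)"
    unfolding T_def by (rule sum.cong[OF refl]) (rule sum.swap)
  also have "\<dots> = T m m + (\<Sum>j\<in>C. T m j) + (\<Sum>i\<in>R. T i m) + (\<Sum>i\<in>R. \<Sum>j\<in>C. T i j)"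
    using finRC mRC by (simp add: sum.distrib)
  also have "T m m = y * S B"
    unfolding T_def S_def sum_distrib_left
  proof (intro sum.cong refl)
    fix r c assume "r \<in> young_subgroup B rw" "c \<in> young_subgroup B cl"
    then have "r \<circ> c permutes B" by (intro permutes_compose) (auto dest: young_subgroup_permutes)
    then show "of_int (sign (transpose m m \<circ> c)) *
          y ^ ncycles A (r \<circ> transpose m m \<circ> (transpose m m \<circ> c)) =
          y * (of_int (sign c) * y ^ ncycles B (r \<circ> c))"
      using ncycles_insert_fixed[OF finB mB] by (simp add: A)
  qed
  also have "(\<Sum>j\<in>C. T m j) = - (of_nat (rw m - 1) * S B)"
  proof -
    have "T m j = - S B" if j: "j \<in> C" for j
      unfolding T_def S_def sum_negf[symmetric]
    proof (intro sum.cong refl)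
      fix r c assume rc: "r \<in> young_subgroup B rw" "c \<in> young_subgroup B cl"
      then have p: "r permutes B" "c permutes B" by (auto dest: young_subgroup_permutes)
      have jB: "j \<in> B" "j \<noteq> m" using j mB by (auto simp: C_def)
      have pA: "r permutes A" "c permutes A" using p by (auto intro: permutes_subset simp: A)
      \<comment> \<open>Cyclic invariance brings the transposition to the right end, where
        \<open>ncycles_insert_cycle\<close> absorbs \<open>m\<close>.\<close>
      have "ncycles A (r \<circ> (transpose j m \<circ> c)) = ncycles A (r \<circ> transpose j m \<circ> c)"
        by (simp add: o_assoc)
      also have "\<dots> = ncycles A (c \<circ> (r \<circ> transpose j m))"
        by (rule ncycles_comp_commute[OF pA(2), symmetric])
      also have "\<dots> = ncycles A (c \<circ> r \<circ> transpose j m)"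
        by (simp add: o_assoc)
      also have "\<dots> = ncycles B (c \<circ> r)"
        unfolding A using p jB by (intro ncycles_insert_cycle finB mB permutes_compose)
      also have "\<dots> = ncycles B (r \<circ> c)" by (rule ncycles_comp_commute[OF p(2)])
      finally have "ncycles A (r \<circ> (transpose j m \<circ> c)) = ncycles B (r \<circ> c)" .
      moreover have "sign (transpose j m \<circ> c) = - sign c"
        using permutes_imp_permutation[OF finB p(2)] jB
        by (simp add: sign_compose permutation_swap_id sign_swap_id)
      ultimately show "of_int (sign (transpose j m \<circ> c)) *
          y ^ ncycles A (r \<circ> transpose m m \<circ> (transpose j m \<circ> c)) =
          - (of_int (sign c) * y ^ ncycles B (r \<circ> c))" by simp
    qed
    then show ?thesis by (simp add: cardC)
  qed
  also have "(\<Sum>i\<in>R. T i m) = of_nat (cl m - 1) * S B"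
  proof -
    have "T i m = S B" if i: "i \<in> R" for i
      unfolding T_def S_def
    proof (intro sum.cong refl)
      fix r c assume rc: "r \<in> young_subgroup B rw" "c \<in> young_subgroup B cl"
      then have p: "r permutes B" "c permutes B" by (auto dest: young_subgroup_permutes)
      have iB: "i \<in> B" using i by (auto simp: R_def)
      have pA: "r permutes A" "c permutes A" using p by (auto intro: permutes_subset simp: A)
      have "ncycles A (r \<circ> transpose i m \<circ> c) = ncycles A (c \<circ> (r \<circ> transpose i m))"
        by (rule ncycles_comp_commute[OF pA(2), symmetric])
      also have "\<dots> = ncycles A (c \<circ> r \<circ> transpose i m)"
        by (simp add: o_assoc)
      also have "\<dots> = ncycles B (c \<circ> r)"
        unfolding A using p iB by (intro ncycles_insert_cycle finB mB permutes_compose)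
      also have "\<dots> = ncycles B (r \<circ> c)" by (rule ncycles_comp_commute[OF p(2)])
      finally show "of_int (sign (transpose m m \<circ> c)) *
          y ^ ncycles A (r \<circ> transpose i m \<circ> (transpose m m \<circ> c)) =
          of_int (sign c) * y ^ ncycles B (r \<circ> c)" by simp
    qed
    then show ?thesis by (simp add: cardR)
  qed
  also have "(\<Sum>i\<in>R. \<Sum>j\<in>C. T i j) = 0"
  proof (intro sum.neutral ballI)
    fix i j assume i: "i \<in> R" and j: "j \<in> C"
    then have iB: "i \<in> B" "rw i = rw m" and jB: "j \<in> B" "cl j = cl m"
      by (auto simp: R_def C_def)
    have ne: "cl i \<noteq> cl m" "rw j \<noteq> rw m"
      using inj[of i m] inj[of j m] iB jB m mB by (auto simp: A)
    have le: "cl i \<le> cl m" "rw j \<le> rw m"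
      using max[of i] max[of j] iB jB by (auto simp: A)
    \<comment> \<open>The box in the row of \<open>j\<close> and the column of \<open>i\<close>. It
      is in the diagram since it lies weakly above and to the left of \<open>m\<close>, and it makes
      \<open>sum_row_col_transpose_eq_0\<close> applicable.\<close>
    obtain k where k: "k \<in> A" "rw k = rw j" "cl k = cl i"
      using young_shape_box[OF ys m(1) _ le(2) _ le(1)] pos iB jB by (auto simp: A)
    have kB: "k \<in> B" using k ne by (auto simp: A)
    have dist: "i \<noteq> j" "i \<noteq> k" "j \<noteq> k" "i \<noteq> m" "j \<noteq> m"
      using iB jB k ne mB by auto
    have "T i j = - (\<Sum>r\<in>young_subgroup B rw. \<Sum>c\<in>young_subgroup B cl.
            of_int (sign c) * y ^ ncycles B (r \<circ> transpose i j \<circ> c))"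
      unfolding T_def sum_negf[symmetric]
    proof (intro sum.cong refl)
      fix r c assume rc: "r \<in> young_subgroup B rw" "c \<in> young_subgroup B cl"
      then have p: "r permutes B" "c permutes B" by (auto dest: young_subgroup_permutes)
      have pA: "c permutes A" using p by (auto intro: permutes_subset simp: A)
      \<comment> \<open>This confines \<open>m\<close> to a single transposition, which can be
        absorbed, and leaves the transposition of \<open>i\<close> and \<open>j\<close> acting
        inside \<open>B\<close>.\<close>
      have braid: "transpose i m \<circ> transpose j m = transpose i j \<circ> transpose i m"
        using dist by (auto simp: transpose_def fun_eq_iff)
      have "r \<circ> transpose i m \<circ> (transpose j m \<circ> c) = r \<circ> (transpose i m \<circ> transpose j m) \<circ> c"
        by (simp add: o_assoc)
      also have "\<dots> = r \<circ> transpose i j \<circ> transpose i m \<circ> c"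
        unfolding braid by (simp add: o_assoc)
      finally have "ncycles A (r \<circ> transpose i m \<circ> (transpose j m \<circ> c)) =
          ncycles A (r \<circ> transpose i j \<circ> transpose i m \<circ> c)" by simp
      also have "\<dots> = ncycles A (c \<circ> (r \<circ> transpose i j \<circ> transpose i m))"
        by (rule ncycles_comp_commute[OF pA, symmetric])
      also have "\<dots> = ncycles A (c \<circ> (r \<circ> transpose i j) \<circ> transpose i m)"
        by (simp add: o_assoc)
      also have "\<dots> = ncycles B (c \<circ> (r \<circ> transpose i j))"
        unfolding A using p iB jB
        by (intro ncycles_insert_cycle finB mB permutes_compose permutes_swap_id) auto
      also have "\<dots> = ncycles B (r \<circ> transpose i j \<circ> c)" by (rule ncycles_comp_commute[OF p(2)])
      finally have "ncycles A (r \<circ> transpose i m \<circ> (transpose j m \<circ> c)) =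
        ncycles B (r \<circ> transpose i j \<circ> c)" .
      moreover have "sign (transpose j m \<circ> c) = - sign c"
        using permutes_imp_permutation[OF finB p(2)] dist
        by (simp add: sign_compose permutation_swap_id sign_swap_id)
      ultimately show "of_int (sign (transpose j m \<circ> c)) *
          y ^ ncycles A (r \<circ> transpose i m \<circ> (transpose j m \<circ> c)) =
          - (of_int (sign c) * y ^ ncycles B (r \<circ> transpose i j \<circ> c))" by simp
    qed
    also have "\<dots> = 0"
      using sum_row_col_transpose_eq_0[OF finB iB(1) jB(1) kB, of rw cl "\<lambda>s. y ^ ncycles B s"]
        k dist by simp
    finally show "T i j = 0" .
  qed
  also have "y * S B + - (of_nat (rw m - 1) * S B) + of_nat (cl m - 1) * S B + 0 =
      (y - of_nat (rw m) + of_nat (cl m)) * S B"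
    using pos[OF m(1)] by (simp add: of_nat_diff algebra_simps)
  also have "\<dots> = (\<Prod>k\<in>A. y - of_nat (rw k) + of_nat (cl k))"
    unfolding IH A prod.insert[OF finB mB] ..
  finally show ?case unfolding S_def .
qed

section \<open>Straightening tabloids\<close>

lemma sum_apply: "(\<Sum>i\<in>I. f i) x = (\<Sum>i\<in>I. f i x)"
  for f :: "'i \<Rightarrow> 'a \<Rightarrow> 'b::comm_monoid_add"
  by (induction I rule: infinite_finite_induct) (auto simp: zero_fun_def plus_fun_def)

text \<open>Exchange argument: as many elements enter as leave, and each entering one exceeds
  everything in \<open>I\<close>, so the sum grows by at least the number exchanged. This surplus
  also settles the case of equality.\<close>

lemma sum_initial_segment:
  fixes I S :: "nat set"
  assumes fin: "finite I" "finite S" and card: "card S = card I"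
    and init: "\<And>x y. x \<in> S \<Longrightarrow> x \<notin> I \<Longrightarrow> y \<in> I \<Longrightarrow> y < x"
  shows "\<Sum>I \<le> \<Sum>S" and "\<Sum>S = \<Sum>I \<Longrightarrow> S = I"
proof -
  have dec: "\<Sum>S = \<Sum>(S \<inter> I) + \<Sum>(S - I)" "\<Sum>I = \<Sum>(S \<inter> I) + \<Sum>(I - S)"
    using fin by (metis sum.Int_Diff, metis sum.Int_Diff Int_commute)
  have cd: "card (S - I) = card (I - S)"
    using card fin card_Diff_subset_Int[of S I] card_Diff_subset_Int[of I S]
    by (simp add: Int_commute)
  have *: "\<Sum>(I - S) + card (S - I) \<le> \<Sum>(S - I)"
  proof (cases "I = {}")
    case True then show ?thesis using card fin by auto
  next
    case False
    let ?h = "Max I"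
    have "\<Sum>(I - S) \<le> of_nat (card (I - S)) * ?h"
      by (rule sum_bounded_above) (use fin in auto)
    moreover have "of_nat (card (S - I)) * Suc ?h \<le> \<Sum>(S - I)"
      by (rule sum_bounded_below) (use fin False init Max_in in \<open>auto simp: Suc_le_eq\<close>)
    ultimately show ?thesis using cd by simp
  qed
  show "\<Sum>I \<le> \<Sum>S" using dec * by simp
  assume "\<Sum>S = \<Sum>I"
  then have "card (S - I) = 0" using dec * by simp
  moreover from this have "card (I - S) = 0" using cd by simp
  ultimately have "S - I = {}" "I - S = {}" using fin card_0_eq finite_Diff by blast+
  then show "S = I" by blast
qed

text \<open>In each column the sum of the labels \<open>rw (\<tau> k)\<close> is at least that of \<open>rw k\<close>, and the totals
  agree, so both labellings use the same labels in every column.\<close>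

lemma column_injective_straighten:
  assumes ys: "young_shape A rw cl" and \<tau>: "\<tau> permutes A"
    and inj: "\<And>k l. k \<in> A \<Longrightarrow> l \<in> A \<Longrightarrow> cl k = cl l \<Longrightarrow> rw (\<tau> k) = rw (\<tau> l) \<Longrightarrow> k = l"
  shows "\<exists>c\<in>young_subgroup A cl. rw \<circ> \<tau> \<circ> c = rw"
proof -
  define T where "T = rw \<circ> \<tau>"
  define column where "column j = {k \<in> A. cl k = j}" for j
  have fin: "finite A" by (rule young_shape_finite[OF ys])
  have finc: "finite (column j)" for j using fin by (simp add: column_def)
  have injT: "inj_on T (column j)" and injR: "inj_on rw (column j)" for j
    using inj young_shape_inj[OF ys] by (auto simp: inj_on_def column_def T_def)
  \<comment> \<open>A column contains every row index up to its height, so a positive label missing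
    from it exceeds all those present. Positivity holds because \<open>\<tau>\<close> maps
    \<open>A\<close> to itself.\<close>
  have seg: "y < x" if x: "x \<in> T ` column j" "x \<notin> rw ` column j" and y: "y \<in> rw ` column j" for x y j
  proof (rule ccontr)
    assume "\<not> y < x"
    obtain k where k: "k \<in> A" "rw k = y" "cl k = j" using y by (auto simp: column_def)
    obtain l where l: "l \<in> A" "x = rw (\<tau> l)" using x by (auto simp: column_def T_def)
    have "1 \<le> x" using young_shape_pos(1)[OF ys] l permutes_in_image[OF \<tau>] by blast
    then obtain b where "b \<in> A" "rw b = x" "cl b = j"
      using young_shape_box[OF ys k(1), of x j] young_shape_pos(2)[OF ys k(1)] k \<open>\<not> y < x\<close>
      by (metis not_less order_refl)
    then show False using x(2) by (auto simp: column_def)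
  qed
  have card_eq: "card (T ` column j) = card (rw ` column j)" for j
    by (simp add: card_image injT injR)
  note seg_facts = sum_initial_segment[OF finite_imageI[OF finc] finite_imageI[OF finc] card_eq seg]
  have le: "(\<Sum>k\<in>column j. rw k) \<le> (\<Sum>k\<in>column j. T k)" for j
    using seg_facts(1)[of j] by (simp add: sum.reindex[OF injT] sum.reindex[OF injR])
  have group: "(\<Sum>j\<in>cl ` A. \<Sum>k\<in>column j. f k) = (\<Sum>k\<in>A. f k)" for f :: "nat \<Rightarrow> nat"
    unfolding column_def by (rule sum.group) (use fin in auto)
  have "(\<Sum>k\<in>A. T k) = (\<Sum>k\<in>A. rw k)"
    using sum.permute[OF \<tau>, of rw] by (simp add: T_def)
  then have "(\<Sum>j\<in>cl ` A. \<Sum>k\<in>column j. T k) = (\<Sum>j\<in>cl ` A. \<Sum>k\<in>column j. rw k)"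
    by (simp add: group)
  then have eq: "(\<Sum>k\<in>column j. T k) = (\<Sum>k\<in>column j. rw k)" if "j \<in> cl ` A" for j
    using sum_mono_inv[of "\<lambda>j. \<Sum>k\<in>column j. rw k" "cl ` A" "\<lambda>j. \<Sum>k\<in>column j. T k" j] le that fin
    by simp
  have img: "T ` column j = rw ` column j" if "j \<in> cl ` A" for j
    using seg_facts(2)[of j] eq[OF that] by (simp add: sum.reindex[OF injT] sum.reindex[OF injR])
  have "\<exists>l\<in>A. rw l = T k \<and> cl l = cl k" if "k \<in> A" for k
  proof -
    have "T k \<in> T ` column (cl k)" using that by (auto simp: column_def)
    then have "T k \<in> rw ` column (cl k)" using img[of "cl k"] that by simp
    then show ?thesis by (auto simp: column_def)
  qed
  then obtain g0 where g0: "\<And>k. k \<in> A \<Longrightarrow> g0 k \<in> A \<and> rw (g0 k) = T k \<and> cl (g0 k) = cl k" by metis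
  \<comment> \<open>\<open>g\<close> sends an entry to the entry of the same column whose row is
    \<open>T k\<close>. It is injective because \<open>T\<close> is injective on columns, and its
    inverse is the required column permutation.\<close>
  define g where "g k = (if k \<in> A then g0 k else k)" for k
  have "inj_on g A"
    using g0 inj by (auto simp: inj_on_def g_def T_def) metis
  moreover have "g ` A \<subseteq> A" using g0 by (auto simp: g_def)
  ultimately have "bij_betw g A A"
    using fin by (simp add: bij_betw_def endo_inj_surj)
  then have gp: "g permutes A" by (rule bij_imp_permutes) (simp add: g_def)
  have gY: "g \<in> young_subgroup A cl"
    using gp g0 by (simp add: young_subgroup_def g_def)
  have "rw \<circ> g = rw \<circ> \<tau>"
    using g0 permutes_not_in[OF \<tau>] by (auto simp: fun_eq_iff g_def T_def)
  then have "rw \<circ> \<tau> \<circ> Hilbert_Choice.inv g = rw"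
    using permutes_inv_o(1)[OF gp] by (metis comp_id o_assoc)
  then show ?thesis using young_subgroup_inv[OF gY] by blast
qed

text \<open>The coefficient of the tabloid \<open>T\<close> in a polytabloid, expressed by labels
  alone: the tabloid of \<open>c \<circ> t\<close> is \<open>rw\<close> composed with the inverse of
  \<open>c\<close>, so it equals \<open>T\<close> exactly when
  \<open>T \<circ> c = rw\<close>.\<close>

definition polytabloid_vec :: "nat set \<Rightarrow> tabloid \<Rightarrow> (nat \<Rightarrow> nat) \<Rightarrow> tvec" where
  "polytabloid_vec A rw cl T =
     (\<Sum>c\<in>young_subgroup A cl. of_int (sign c) * (if T \<circ> c = rw then 1 else 0))"

text \<open>Translating the summation index by \<open>c\<close> costs one factor
  \<open>sign c\<close>, which is its own inverse.\<close>

lemma polytabloid_vec_antisym: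
  assumes "finite A" "c \<in> young_subgroup A cl"
  shows "polytabloid_vec A rw cl (T \<circ> c) = of_int (sign c) * polytabloid_vec A rw cl T"
proof -
  have perm: "permutation s" if "s \<in> young_subgroup A cl" for s
    using permutes_imp_permutation[OF assms(1) young_subgroup_permutes[OF that]] .
  have "of_int (sign c) * polytabloid_vec A rw cl T = of_int (sign c) *
      (\<Sum>s\<in>young_subgroup A cl. of_int (sign (c \<circ> s)) * (if T \<circ> (c \<circ> s) = rw then 1 else 0))"
    unfolding polytabloid_vec_def
    by (subst sum_young_subgroup_left[OF assms(2), symmetric]) (rule refl)
  also have "\<dots> = (\<Sum>s\<in>young_subgroup A cl.
      of_int (sign c * (sign c * sign s)) * (if T \<circ> (c \<circ> s) = rw then 1 else 0))"
    unfolding sum_distrib_left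
    using perm assms(2) by (intro sum.cong refl) (simp add: sign_compose del: sign_left_idempotent)
  also have "\<dots> = polytabloid_vec A rw cl (T \<circ> c)"
    by (simp only: sign_left_idempotent polytabloid_vec_def o_assoc)
  finally show ?thesis by simp
qed

lemma young_subgroup_Int:
  assumes "young_shape A rw cl" "s \<in> young_subgroup A rw" "s \<in> young_subgroup A cl"
  shows "s = id"
proof
  fix k show "s k = id k"
  proof (cases "k \<in> A")
    case True
    then show ?thesis
      using young_shape_inj[OF assms(1), of "s k" k] assms(2,3)
        permutes_in_image[OF young_subgroup_permutes[OF assms(2)]]
      by (simp add: young_subgroup_label)
  next
    case False
    then show ?thesis using young_subgroup_permutes[OF assms(2)] by (simp add: permutes_not_in)
  qed
qed

lemma comp_eq_iff_young_subgroup: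
  "s permutes A \<Longrightarrow> f \<circ> s = f \<longleftrightarrow> s \<in> young_subgroup A f"
  by (auto simp: fun_eq_iff young_subgroup_label) (auto simp: young_subgroup_def)

text \<open>Only the identity contributes, as row and column stabilisers meet trivially. This
  coefficient calibrates the scalar in \<open>cycle_sum_polytabloid_vec\<close> and shows that
  polytabloids are nonzero.\<close>

lemma polytabloid_vec_self:
  assumes "young_shape A rw cl"
  shows "polytabloid_vec A rw cl rw = 1"
proof -
  have "(of_int (sign c) * (if rw \<circ> c = rw then 1 else 0) :: complex) = (if c = id then 1 else 0)"
    if c: "c \<in> young_subgroup A cl" for c
  proof (cases "rw \<circ> c = rw")
    case True
    then have "c \<in> young_subgroup A rw"
      using comp_eq_iff_young_subgroup[OF young_subgroup_permutes[OF c]] by blast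
    then show ?thesis using young_subgroup_Int[OF assms _ c] by simp
  qed auto
  then show ?thesis
    unfolding polytabloid_vec_def
    using id_in_young_subgroup[of A cl] finite_young_subgroup[OF young_shape_finite[OF assms], of cl]
    by simp
qed

text \<open>As functions of \<open>T\<close> both sides are antisymmetric under the column
  stabiliser and agree at \<open>rw\<close>. They vanish when \<open>T\<close> is not
  \<open>rw\<close> composed with a permutation, and when \<open>T\<close> repeats a label within a
  column; every other \<open>T\<close> straightens to \<open>rw\<close>.\<close>

lemma cycle_sum_polytabloid_vec:
  fixes y :: complex
  assumes ys: "young_shape A rw cl"
  shows "(\<Sum>\<sigma> | \<sigma> permutes A. y ^ ncycles A \<sigma> * polytabloid_vec A rw cl (T \<circ> \<sigma>)) =
         (\<Sum>r\<in>young_subgroup A rw. \<Sum>c\<in>young_subgroup A cl. of_int (sign c) * y ^ ncycles A (r \<circ> c)) *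
         polytabloid_vec A rw cl T"
proof -
  define e where "e = polytabloid_vec A rw cl"
  define Z where "Z T = (\<Sum>\<sigma> | \<sigma> permutes A. y ^ ncycles A \<sigma> * e (T \<circ> \<sigma>))" for T
  define s where "s = (\<Sum>r\<in>young_subgroup A rw. \<Sum>c\<in>young_subgroup A cl.
      of_int (sign c) * y ^ ncycles A (r \<circ> c))"
  have fin: "finite A" by (rule young_shape_finite[OF ys])
  have finY: "finite (young_subgroup A f)" for f :: "nat \<Rightarrow> nat" by (rule finite_young_subgroup[OF fin])
  have finP: "finite {\<sigma>. \<sigma> permutes A}" by (rule finite_permutations[OF fin])
  have anti: "e (T \<circ> c) = of_int (sign c) * e T" if "c \<in> young_subgroup A cl" for T c
    unfolding e_def by (rule polytabloid_vec_antisym[OF fin that])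
  have Zanti: "Z (T \<circ> c) = of_int (sign c) * Z T" if c: "c \<in> young_subgroup A cl" for T c
  proof -
    have cp: "c permutes A" by (rule young_subgroup_permutes[OF c])
    let ?i = "Hilbert_Choice.inv c"
    have ip: "?i permutes A" by (rule permutes_inv[OF cp])
    \<comment> \<open>Conjugation by \<open>c\<close> preserves the number of cycles and turns the
      argument of \<open>e\<close> into \<open>T \<circ> \<sigma> \<circ> c\<close>, where the
      antisymmetry of \<open>e\<close> applies.\<close>
    have "Z (T \<circ> c) = (\<Sum>\<sigma> | \<sigma> permutes A. y ^ ncycles A (?i \<circ> (\<sigma> \<circ> c)) * e (T \<circ> c \<circ> (?i \<circ> (\<sigma> \<circ> c))))"
      unfolding Z_def
    proof (rule sum.reindex_bij_witness[where i = "\<lambda>\<sigma>. ?i \<circ> (\<sigma> \<circ> c)" and j = "\<lambda>\<sigma>. c \<circ> (\<sigma> \<circ> ?i)"])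
      fix a assume "a \<in> {\<sigma>. \<sigma> permutes A}"
      then show "c \<circ> (a \<circ> ?i) \<in> {\<sigma>. \<sigma> permutes A}" "?i \<circ> (a \<circ> c) \<in> {\<sigma>. \<sigma> permutes A}"
        by (auto intro!: permutes_compose cp ip)
      have i1: "?i \<circ> (c \<circ> a') = a'" "c \<circ> (?i \<circ> a') = a'" for a' :: "nat \<Rightarrow> nat"
        by (simp_all add: o_assoc permutes_inv_o[OF cp])
      show A1: "?i \<circ> (c \<circ> (a \<circ> ?i) \<circ> c) = a"
        by (simp only: o_assoc[symmetric]) (simp add: i1, simp add: permutes_inv_o[OF cp])
      show "c \<circ> (?i \<circ> (a \<circ> c) \<circ> ?i) = a"
        by (simp only: o_assoc[symmetric]) (simp add: i1, simp add: permutes_inv_o[OF cp])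
      show "y ^ ncycles A (?i \<circ> (c \<circ> (a \<circ> ?i) \<circ> c)) * e (T \<circ> c \<circ> (?i \<circ> (c \<circ> (a \<circ> ?i) \<circ> c))) =
            y ^ ncycles A a * e (T \<circ> c \<circ> a)" by (simp only: A1)
    qed
    also have "\<dots> = (\<Sum>\<sigma> | \<sigma> permutes A. y ^ ncycles A \<sigma> * (of_int (sign c) * e (T \<circ> \<sigma>)))"
    proof (intro sum.cong refl)
      fix \<sigma> assume "\<sigma> \<in> {\<sigma>. \<sigma> permutes A}"
      have "ncycles A (?i \<circ> (\<sigma> \<circ> c)) = ncycles A (\<sigma> \<circ> c \<circ> ?i)"
        by (rule ncycles_comp_commute[OF ip])
      also have "\<sigma> \<circ> c \<circ> ?i = \<sigma>" by (simp add: o_assoc[symmetric] permutes_inv_o[OF cp])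
      finally have "ncycles A (?i \<circ> (\<sigma> \<circ> c)) = ncycles A \<sigma>" .
      moreover have "T \<circ> c \<circ> (?i \<circ> (\<sigma> \<circ> c)) = T \<circ> (c \<circ> ?i) \<circ> \<sigma> \<circ> c" by (simp only: o_assoc)
      ultimately show "y ^ ncycles A (?i \<circ> (\<sigma> \<circ> c)) * e (T \<circ> c \<circ> (?i \<circ> (\<sigma> \<circ> c))) =
          y ^ ncycles A \<sigma> * (of_int (sign c) * e (T \<circ> \<sigma>))"
        using anti[OF c, of "T \<circ> \<sigma>"] by (simp add: permutes_inv_o[OF cp])
    qed
    also have "\<dots> = of_int (sign c) * Z T"
      by (simp add: Z_def sum_distrib_left mult_ac)
    finally show ?thesis .
  qed
  have Zrw: "Z rw = s"
  proof -
    have "Z rw = (\<Sum>c\<in>young_subgroup A cl. of_int (sign c) *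
        (\<Sum>\<sigma> | \<sigma> permutes A. if rw \<circ> \<sigma> \<circ> c = rw then y ^ ncycles A \<sigma> else 0))"
      unfolding Z_def e_def polytabloid_vec_def sum_distrib_left
      by (subst sum.swap) (intro sum.cong refl, simp)
    \<comment> \<open>For fixed \<open>c\<close> the condition says that
      \<open>\<sigma> \<circ> c\<close> preserves row labels, so \<open>\<sigma>\<close> is a row
      permutation followed on the right by the inverse of \<open>c\<close>.\<close>
    also have "\<dots> = (\<Sum>c\<in>young_subgroup A cl. of_int (sign c) *
        (\<Sum>r\<in>young_subgroup A rw. y ^ ncycles A (r \<circ> Hilbert_Choice.inv c)))"
    proof (rule sum.cong[OF refl])
      fix c assume "c \<in> young_subgroup A cl"
      then have cp: "c permutes A" by (rule young_subgroup_permutes)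
      let ?i = "Hilbert_Choice.inv c"
      have "(\<Sum>\<sigma> | \<sigma> permutes A. if rw \<circ> \<sigma> \<circ> c = rw then y ^ ncycles A \<sigma> else 0) =
            (\<Sum>\<sigma> | \<sigma> permutes A. if rw \<circ> (\<sigma> \<circ> ?i) \<circ> c = rw then y ^ ncycles A (\<sigma> \<circ> ?i) else 0)"
        by (rule sum_permutations_compose_right[OF permutes_inv[OF cp]])
      also have "\<dots> = (\<Sum>\<sigma> | \<sigma> permutes A. if \<sigma> \<in> young_subgroup A rw then y ^ ncycles A (\<sigma> \<circ> ?i) else 0)"
        by (intro sum.cong refl if_cong)
           (simp_all add: o_assoc[symmetric] permutes_inv_o[OF cp] comp_eq_iff_young_subgroup)
      also have "\<dots> = (\<Sum>\<sigma> | \<sigma> \<in> {\<sigma>. \<sigma> permutes A} \<and> \<sigma> \<in> young_subgroup A rw. y ^ ncycles A (\<sigma> \<circ> ?i))"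
        by (rule sum.inter_filter[OF finP, symmetric])
      also have "{\<sigma>. \<sigma> \<in> {\<sigma>. \<sigma> permutes A} \<and> \<sigma> \<in> young_subgroup A rw} = young_subgroup A rw"
        by (auto dest: young_subgroup_permutes)
      finally show "of_int (sign c) * (\<Sum>\<sigma> | \<sigma> permutes A. if rw \<circ> \<sigma> \<circ> c = rw then y ^ ncycles A \<sigma> else 0) =
        of_int (sign c) * (\<Sum>r\<in>young_subgroup A rw. y ^ ncycles A (r \<circ> ?i))" by (rule arg_cong)
    qed
    also have "\<dots> = (\<Sum>c\<in>young_subgroup A cl. of_int (sign (Hilbert_Choice.inv c)) *
        (\<Sum>r\<in>young_subgroup A rw. y ^ ncycles A (r \<circ> Hilbert_Choice.inv c)))"
      by (intro sum.cong refl)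
         (simp add: sign_inverse permutes_imp_permutation[OF fin young_subgroup_permutes])
    also have "\<dots> = (\<Sum>c\<in>young_subgroup A cl. of_int (sign c) *
        (\<Sum>r\<in>young_subgroup A rw. y ^ ncycles A (r \<circ> c)))"
      by (rule sum_young_subgroup_inv)
    also have "\<dots> = s"
      unfolding s_def sum_distrib_left by (rule sum.swap)
    finally show ?thesis .
  qed
  have "Z T = s * e T"
  proof (cases "\<exists>\<tau>. \<tau> permutes A \<and> T = rw \<circ> \<tau>")
    case False
    have e0: "e (T \<circ> \<sigma>) = 0" if \<sigma>: "\<sigma> permutes A" for \<sigma>
    proof -
      have "T \<circ> \<sigma> \<circ> c \<noteq> rw" if "c \<in> young_subgroup A cl" for c
      proof
        assume eq: "T \<circ> \<sigma> \<circ> c = rw"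
        have p: "\<sigma> \<circ> c permutes A" using \<sigma> young_subgroup_permutes[OF that] by (metis permutes_compose)
        have "T = T \<circ> ((\<sigma> \<circ> c) \<circ> Hilbert_Choice.inv (\<sigma> \<circ> c))"
          by (simp add: permutes_inv_o[OF p])
        also have "\<dots> = T \<circ> \<sigma> \<circ> c \<circ> Hilbert_Choice.inv (\<sigma> \<circ> c)" by (simp only: o_assoc)
        finally show False using eq permutes_inv[OF p] False by auto
      qed
      then show ?thesis by (simp add: e_def polytabloid_vec_def)
    qed
    then have "Z T = 0" by (simp add: Z_def)
    moreover have "e T = 0" using e0[OF permutes_id] by simp
    ultimately show ?thesis by simp
  next
    case True
    then obtain \<tau> where \<tau>: "\<tau> permutes A" "T = rw \<circ> \<tau>" by blast
    show ?thesis
    proof (cases "\<exists>k\<in>A. \<exists>l\<in>A. k \<noteq> l \<and> cl k = cl l \<and> T k = T l")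
      case True
      then obtain k l where kl: "k \<in> A" "l \<in> A" "k \<noteq> l" "cl k = cl l" "T k = T l" by blast
      have t: "transpose k l \<in> young_subgroup A cl" using kl by (intro transpose_in_young_subgroup)
      \<comment> \<open>A column transposition fixes \<open>T\<close> but has sign -1, so both
        values equal their own negatives.\<close>
      have Tt: "T \<circ> transpose k l = T" using kl by (auto simp: fun_eq_iff transpose_def)
      have "Z T = - Z T" "e T = - e T"
        using Zanti[OF t, of T] anti[OF t, of T] kl(3) by (simp_all add: Tt sign_swap_id)
      then show ?thesis by simp
    next
      case False
      then obtain c where c: "c \<in> young_subgroup A cl" "T \<circ> c = rw"
        using column_injective_straighten[OF ys \<tau>(1)] unfolding \<tau>(2) by (metis comp_apply)
      have "s = of_int (sign c) * Z T" using Zanti[OF c(1), of T] by (simp add: c(2) Zrw)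
      moreover have "1 = of_int (sign c) * e T"
        using anti[OF c(1), of T] polytabloid_vec_self[OF ys] by (simp add: c(2) e_def)
      moreover have "(of_int (sign c) :: complex) * of_int (sign c) = 1"
        by (metis of_int_1 of_int_mult sign_idempotent)
      ultimately show ?thesis
        by (metis mult.assoc mult.commute mult.right_neutral)
    qed
  qed
  then show ?thesis by (simp add: Z_def s_def e_def)
qed

section \<open>Specht modules\<close>

lemma finite_young_diagram: "finite (young_diagram lam)"
  and card_young_diagram: "card (young_diagram lam) = sum_list lam"
proof -
  have D: "young_diagram lam = (SIGMA i:{1..length lam}. {1..lam ! (i - 1)})"
    by (auto simp: young_diagram_def)
  show "finite (young_diagram lam)" by (simp add: D)
  have "card (young_diagram lam) = (\<Sum>i\<in>{1..length lam}. lam ! (i - 1))"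
    by (simp add: D)
  also have "\<dots> = (\<Sum>i<length lam. lam ! i)"
    by (rule sum.reindex_bij_witness[where i = Suc and j = "\<lambda>i. i - 1"]) auto
  also have "\<dots> = sum_list lam" by (simp add: sum_list_sum_nth atLeast0LessThan)
  finally show "card (young_diagram lam) = sum_list lam" .
qed

lemma young_diagram_down_closed:
  assumes "is_partition n lam" "(i, j) \<in> young_diagram lam" "1 \<le> i'" "i' \<le> i" "1 \<le> j'" "j' \<le> j"
  shows "(i', j') \<in> young_diagram lam"
proof -
  have "lam ! (i - 1) \<le> lam ! (i' - 1)"
  proof (cases "i' = i")
    case False
    then have "i' - 1 < i - 1" "i - 1 < length lam"
      using assms by (auto simp: young_diagram_def)
    then show ?thesis
      using assms(1) unfolding is_partition_def by (metis sorted_wrt_nth_less)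
  qed simp
  then show ?thesis using assms by (auto simp: young_diagram_def)
qed

text \<open>The column counterpart of \<open>tabloid_of\<close>, but unspecified off
  \<open>{1..n}\<close>; \<open>young_subgroup {1..n}\<close> tests labels only inside that
  range.\<close>

definition tableau_col :: "nat list \<Rightarrow> (nat \<times> nat \<Rightarrow> nat) \<Rightarrow> nat \<Rightarrow> nat" where
  "tableau_col lam t k = snd (inv_into (young_diagram lam) t k)"

lemma tabloid_tableau_col:
  assumes "t \<in> tableaux n lam" "b \<in> young_diagram lam"
  shows "tabloid_of n lam t (t b) = fst b" and "tableau_col lam t (t b) = snd b"
  using assms bij_betwE[of t "young_diagram lam" "{1..n}"]
  by (auto simp: tableaux_def tabloid_of_def tableau_col_def inv_into_f_f[OF bij_betw_imp_inj_on])

lemma tableau_surj: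
  assumes "t \<in> tableaux n lam" "k \<in> {1..n}"
  obtains b where "b \<in> young_diagram lam" "k = t b"
proof -
  have "k \<in> t ` young_diagram lam" using assms by (simp add: tableaux_def bij_betw_def)
  then show ?thesis using that by blast
qed

lemma young_shape_tableau:
  assumes part: "is_partition n lam" and t: "t \<in> tableaux n lam"
  shows "young_shape {1..n} (tabloid_of n lam t) (tableau_col lam t)"
proof (rule young_shapeI)
  note b = tabloid_tableau_col[OF t]
  fix k assume "k \<in> {1..n}"
  then obtain x where x: "x \<in> young_diagram lam" "k = t x" by (rule tableau_surj[OF t])
  then show "1 \<le> tabloid_of n lam t k" "1 \<le> tableau_col lam t k"
    using b[OF x(1)] by (auto simp: young_diagram_def)
  {
    fix l assume "l \<in> {1..n}" and eq: "tabloid_of n lam t k = tabloid_of n lam t l"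
      "tableau_col lam t k = tableau_col lam t l"
    then obtain z where z: "z \<in> young_diagram lam" "l = t z" by (rule_tac tableau_surj[OF t])
    then have "x = z" using eq x b[OF x(1)] b[OF z(1)] by (simp add: prod_eq_iff)
    then show "k = l" using x z by simp
  }
  fix i j assume ij: "1 \<le> i" "i \<le> tabloid_of n lam t k" "1 \<le> j" "j \<le> tableau_col lam t k"
  have "(i, j) \<in> young_diagram lam"
    using young_diagram_down_closed[OF part, of "fst x" "snd x" i j] x ij b[OF x(1)] by simp
  moreover from this have "t (i, j) \<in> {1..n}" using t by (auto simp: tableaux_def bij_betw_def)
  ultimately show "\<exists>l\<in>{1..n}. tabloid_of n lam t l = i \<and> tableau_col lam t l = j"
    using b[of "(i, j)"] by auto
qed simp

lemma prod_tableau_contents: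
  assumes "t \<in> tableaux n lam"
  shows "(\<Prod>k\<in>{1..n}. y - of_nat (tabloid_of n lam t k) + of_nat (tableau_col lam t k)) =
         content_poly lam y"
proof -
  have "bij_betw t (young_diagram lam) {1..n}" using assms by (simp add: tableaux_def)
  then have "(\<Prod>k\<in>{1..n}. y - of_nat (tabloid_of n lam t k) + of_nat (tableau_col lam t k)) =
     (\<Prod>b\<in>young_diagram lam. y - of_nat (tabloid_of n lam t (t b)) + of_nat (tableau_col lam t (t b)))"
    by (rule prod.reindex_bij_betw[symmetric])
  also have "\<dots> = content_poly lam y"
    unfolding content_poly_def
    by (intro prod.cong refl) (auto simp: tabloid_tableau_col[OF assms])
  finally show ?thesis .
qed

lemma comp_tableau:
  assumes "t \<in> tableaux n lam" "\<pi> permutes {1..n}"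
  shows "\<pi> \<circ> t \<in> tableaux n lam"
  using assms bij_betw_trans[OF _ permutes_imp_bij] by (auto simp: tableaux_def)

lemma inv_into_comp_tableau:
  assumes t: "t \<in> tableaux n lam" and \<pi>: "\<pi> permutes {1..n}" and k: "k \<in> {1..n}"
  shows "inv_into (young_diagram lam) (\<pi> \<circ> t) k =
         inv_into (young_diagram lam) t (Hilbert_Choice.inv \<pi> k)"
proof -
  have "Hilbert_Choice.inv \<pi> k \<in> {1..n}"
    using permutes_in_image[OF permutes_inv[OF \<pi>]] k by blast
  then obtain b where b: "b \<in> young_diagram lam" "Hilbert_Choice.inv \<pi> k = t b"
    by (rule tableau_surj[OF t])
  have kb: "k = (\<pi> \<circ> t) b" using b(2) permutes_inverses(1)[OF \<pi>, of k] by simp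
  have "inj_on t (young_diagram lam)" "inj_on (\<pi> \<circ> t) (young_diagram lam)"
    using t comp_tableau[OF t \<pi>] by (auto simp: tableaux_def bij_betw_def)
  then show ?thesis
    unfolding b(2) unfolding kb using b(1) by (simp only: inv_into_f_f)
qed

text \<open>The equation holds at every argument because a permutation of \<open>{1..n}\<close>
  respects the default value 0 outside.\<close>

lemma tabloid_of_comp:
  assumes "t \<in> tableaux n lam" "\<pi> permutes {1..n}"
  shows "tabloid_of n lam (\<pi> \<circ> t) = tabloid_of n lam t \<circ> Hilbert_Choice.inv \<pi>"
proof
  fix k
  show "tabloid_of n lam (\<pi> \<circ> t) k = (tabloid_of n lam t \<circ> Hilbert_Choice.inv \<pi>) k"
    using permutes_in_image[OF permutes_inv[OF assms(2)], of k] inv_into_comp_tableau[OF assms, of k]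
    by (simp add: tabloid_of_def del: atLeastAtMost_iff)
qed

lemma column_stabilizer_eq:
  "column_stabilizer n lam t = young_subgroup {1..n} (tableau_col lam t)"
  by (simp add: column_stabilizer_def young_subgroup_def tableau_col_def)

lemma eq_comp_inv_iff: "\<pi> permutes A \<Longrightarrow> f = g \<circ> Hilbert_Choice.inv \<pi> \<longleftrightarrow> f \<circ> \<pi> = g"
  by (metis comp_id o_assoc permutes_inv_o)

lemma polytabloid_eq_vec:
  assumes "t \<in> tableaux n lam"
  shows "polytabloid n lam t = polytabloid_vec {1..n} (tabloid_of n lam t) (tableau_col lam t)"
proof
  fix T
  have "polytabloid n lam t T = (\<Sum>c\<in>young_subgroup {1..n} (tableau_col lam t).
      of_int (sign c) * (if T = tabloid_of n lam (c \<circ> t) then 1 else 0))"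
    by (simp add: polytabloid_def column_stabilizer_eq sum_apply fscale_def)
  also have "\<dots> = polytabloid_vec {1..n} (tabloid_of n lam t) (tableau_col lam t) T"
    unfolding polytabloid_vec_def
    by (intro sum.cong refl)
       (simp add: tabloid_of_comp[OF assms young_subgroup_permutes]
          eq_comp_inv_iff[OF young_subgroup_permutes])
  finally show "polytabloid n lam t T = \<dots>" .
qed

text \<open>The column stabiliser of \<open>\<pi> \<circ> t\<close> is the conjugate by
  \<open>\<pi>\<close> of that of \<open>t\<close>, and conjugation preserves signs.\<close>

lemma perm_action_polytabloid:
  assumes t: "t \<in> tableaux n lam" and \<pi>: "\<pi> permutes {1..n}"
  shows "perm_action \<pi> (polytabloid n lam t) = polytabloid n lam (\<pi> \<circ> t)"
proof
  fix T
  let ?A = "{1..n}" and ?i = "Hilbert_Choice.inv \<pi>"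
  let ?rw = "tabloid_of n lam t" and ?cl = "tableau_col lam t" and ?cl' = "tableau_col lam (\<pi> \<circ> t)"
  have ip: "?i permutes ?A" by (rule permutes_inv[OF \<pi>])
  have cl': "?cl' k = ?cl (?i k)" if "k \<in> ?A" for k
    unfolding tableau_col_def inv_into_comp_tableau[OF t \<pi> that] ..
  have perm: "permutation s" if "s permutes ?A" for s
    using that permutes_imp_permutation by blast
  have inA: "s k \<in> ?A" if "s permutes ?A" "k \<in> ?A" for s k
    using that permutes_in_image by metis
  have fwd: "\<pi> \<circ> c \<circ> ?i \<in> young_subgroup ?A ?cl'" if c: "c \<in> young_subgroup ?A ?cl" for c
  proof -
    have cp: "c permutes ?A" by (rule young_subgroup_permutes[OF c])
    have "?cl' (\<pi> (c (?i k))) = ?cl' k" if "k \<in> ?A" for k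
      using that inA[OF \<pi>] inA[OF cp] inA[OF ip] permutes_inverses(2)[OF \<pi>] young_subgroup_label[OF c]
      by (simp only: cl')
    then show ?thesis using cp ip \<pi> by (simp add: young_subgroup_def permutes_compose)
  qed
  have bwd: "?i \<circ> c \<circ> \<pi> \<in> young_subgroup ?A ?cl" if c: "c \<in> young_subgroup ?A ?cl'" for c
  proof -
    have cp: "c permutes ?A" by (rule young_subgroup_permutes[OF c])
    have "?cl (?i (c (\<pi> k))) = ?cl k" if k: "k \<in> ?A" for k
    proof -
      have "?cl (?i (c (\<pi> k))) = ?cl' (c (\<pi> k))"
        using cl'[OF inA[OF cp inA[OF \<pi> k]]] by simp
      also have "\<dots> = ?cl' (\<pi> k)" by (rule young_subgroup_label[OF c])
      also have "\<dots> = ?cl k" using cl'[OF inA[OF \<pi> k]] permutes_inverses(2)[OF \<pi>] by simp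
      finally show ?thesis .
    qed
    then show ?thesis using cp ip \<pi> by (simp add: young_subgroup_def permutes_compose)
  qed
  have "perm_action \<pi> (polytabloid n lam t) T = (\<Sum>c\<in>young_subgroup ?A ?cl.
      of_int (sign c) * (if T \<circ> \<pi> \<circ> c = ?rw then 1 else 0))"
    by (simp add: perm_action_def polytabloid_eq_vec[OF t] polytabloid_vec_def)
  also have "\<dots> = (\<Sum>c\<in>young_subgroup ?A ?cl'.
      of_int (sign c) * (if T \<circ> c = ?rw \<circ> ?i then 1 else 0))"
  proof (rule sum.reindex_bij_witness[where i = "\<lambda>c. ?i \<circ> c \<circ> \<pi>" and j = "\<lambda>c. \<pi> \<circ> c \<circ> ?i"])
    fix c assume c: "c \<in> young_subgroup ?A ?cl"
    show "\<pi> \<circ> c \<circ> ?i \<in> young_subgroup ?A ?cl'" by (rule fwd[OF c])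
    show "?i \<circ> (\<pi> \<circ> c \<circ> ?i) \<circ> \<pi> = c"
      by (simp add: fun_eq_iff permutes_inverses[OF \<pi>])
    have "sign (\<pi> \<circ> c \<circ> ?i) = sign c"
      using perm[OF \<pi>] perm[OF ip] perm[OF young_subgroup_permutes[OF c]]
      by (simp add: sign_compose permutation_compose sign_inverse)
    moreover have "T \<circ> (\<pi> \<circ> c \<circ> ?i) = ?rw \<circ> ?i \<longleftrightarrow> T \<circ> \<pi> \<circ> c = ?rw"
    proof -
      have "T \<circ> (\<pi> \<circ> c \<circ> ?i) = ?rw \<circ> ?i \<longleftrightarrow> T \<circ> (\<pi> \<circ> c \<circ> ?i) \<circ> \<pi> = ?rw"
        by (rule eq_comp_inv_iff[OF \<pi>])
      also have "T \<circ> (\<pi> \<circ> c \<circ> ?i) \<circ> \<pi> = T \<circ> \<pi> \<circ> c"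
        by (simp add: fun_eq_iff permutes_inverses[OF \<pi>])
      finally show ?thesis .
    qed
    ultimately show "of_int (sign (\<pi> \<circ> c \<circ> ?i)) * (if T \<circ> (\<pi> \<circ> c \<circ> ?i) = ?rw \<circ> ?i then 1 else 0) =
        of_int (sign c) * (if T \<circ> \<pi> \<circ> c = ?rw then 1 else (0 :: complex))" by simp
  next
    fix c assume c: "c \<in> young_subgroup ?A ?cl'"
    show "?i \<circ> c \<circ> \<pi> \<in> young_subgroup ?A ?cl" by (rule bwd[OF c])
    show "\<pi> \<circ> (?i \<circ> c \<circ> \<pi>) \<circ> ?i = c"
      by (simp add: fun_eq_iff permutes_inverses[OF \<pi>])
  qed
  also have "\<dots> = polytabloid n lam (\<pi> \<circ> t) T"
    by (simp add: polytabloid_eq_vec[OF comp_tableau[OF t \<pi>]] polytabloid_vec_def tabloid_of_comp[OF t \<pi>])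
  finally show "perm_action \<pi> (polytabloid n lam t) T = polytabloid n lam (\<pi> \<circ> t) T" .
qed

lemma perm_action_add: "perm_action \<pi> (v + w) = perm_action \<pi> v + perm_action \<pi> w"
  by (simp add: perm_action_def plus_fun_def)

lemma perm_action_scale: "perm_action \<pi> (fscale c v) = fscale c (perm_action \<pi> v)"
  by (simp add: perm_action_def fscale_def)

lemma perm_action_zero: "perm_action \<pi> 0 = 0"
  by (simp add: perm_action_def zero_fun_def)

lemma perm_action_specht_space:
  assumes \<pi>: "\<pi> permutes {1..n}" and v: "v \<in> specht_space n lam"
  shows "perm_action \<pi> v \<in> specht_space n lam"
proof -
  have "specht_space n lam \<subseteq> {v. perm_action \<pi> v \<in> specht_space n lam}"
    unfolding specht_space_def
  proof (rule fv.span_minimal)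
    show "polytabloid n lam ` tableaux n lam \<subseteq>
        {v. perm_action \<pi> v \<in> fv.span (polytabloid n lam ` tableaux n lam)}"
      using perm_action_polytabloid[OF _ \<pi>] comp_tableau[OF _ \<pi>]
      by (auto intro!: fv.span_base)
    show "fv.subspace {v. perm_action \<pi> v \<in> fv.span (polytabloid n lam ` tableaux n lam)}"
      by (rule fv.subspaceI)
         (auto simp: perm_action_add perm_action_scale perm_action_zero
            intro: fv.span_add fv.span_scale fv.span_zero)
  qed
  then show ?thesis using v by blast
qed

text \<open>The vectors scaled by this constant form a subspace, so the spanning polytabloids
  suffice. For each of them the scalar is a product over boxes, hence the same for all
  tableaux.\<close>

lemma cycle_sum_specht_space:
  fixes y :: complex
  assumes part: "is_partition n lam" and v: "v \<in> specht_space n lam"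
  shows "(\<Sum>\<sigma> | \<sigma> permutes {1..n}.
            fscale (y ^ ncycles {1..n} \<sigma>) (perm_action (Hilbert_Choice.inv \<sigma>) v)) =
         fscale (content_poly lam y) v"
proof -
  define Z where "Z v = (\<Sum>\<sigma> | \<sigma> permutes {1..n}.
      fscale (y ^ ncycles {1..n} \<sigma>) (perm_action (Hilbert_Choice.inv \<sigma>) v))" for v
  have "specht_space n lam \<subseteq> {v. Z v = fscale (content_poly lam y) v}"
    unfolding specht_space_def
  proof (rule fv.span_minimal)
    show "polytabloid n lam ` tableaux n lam \<subseteq> {v. Z v = fscale (content_poly lam y) v}"
    proof clarify
      fix t assume t: "t \<in> tableaux n lam"
      show "Z (polytabloid n lam t) = fscale (content_poly lam y) (polytabloid n lam t)"
      proof
        fix T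
        have "Z (polytabloid n lam t) T = (\<Sum>\<sigma> | \<sigma> permutes {1..n}.
            y ^ ncycles {1..n} \<sigma> * polytabloid n lam t (T \<circ> Hilbert_Choice.inv \<sigma>))"
          by (simp add: Z_def sum_apply fscale_def perm_action_def)
        \<comment> \<open>Writing the cycle count through the inverse as well makes the whole
          summand a function of it, so the sum can be reindexed.\<close>
        also have "\<dots> = (\<Sum>\<sigma> | \<sigma> permutes {1..n}.
            y ^ ncycles {1..n} (Hilbert_Choice.inv \<sigma>) * polytabloid n lam t (T \<circ> Hilbert_Choice.inv \<sigma>))"
          by (intro sum.cong refl) (simp add: ncycles_inv)
        also have "\<dots> = (\<Sum>\<sigma> | \<sigma> permutes {1..n}. y ^ ncycles {1..n} \<sigma> * polytabloid n lam t (T \<circ> \<sigma>))"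
          by (rule sum_permutations_inverse[symmetric])
        also have "\<dots> = content_poly lam y * polytabloid n lam t T"
          unfolding polytabloid_eq_vec[OF t]
            cycle_sum_polytabloid_vec[OF young_shape_tableau[OF part t]]
            young_symmetrizer_cycle_sum[OF young_shape_tableau[OF part t]]
            prod_tableau_contents[OF t] ..
        finally show "Z (polytabloid n lam t) T = fscale (content_poly lam y) (polytabloid n lam t) T"
          by (simp add: fscale_def)
      qed
    qed
    have "Z (v + w) = Z v + Z w" for v w
      by (simp add: Z_def perm_action_add fv.scale_right_distrib sum.distrib)
    moreover have "Z (fscale c v) = fscale c (Z v)" for c v
      by (simp add: Z_def perm_action_scale fv.scale_sum_right mult.commute)
    moreover have "Z 0 = 0" by (simp add: Z_def perm_action_zero)
    ultimately show "fv.subspace {v. Z v = fscale (content_poly lam y) v}"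
      by (intro fv.subspaceI) (simp_all add: fv.scale_right_distrib mult.commute)
  qed
  then show ?thesis using v by (auto simp: Z_def)
qed

section \<open>Basis, dimension and character of the Specht module\<close>

lemma tableaux_nonempty:
  assumes "is_partition n lam"
  shows "tableaux n lam \<noteq> {}"
proof -
  have "card (young_diagram lam) = card {1..n}"
    using assms by (simp add: card_young_diagram is_partition_def)
  then obtain t where "bij_betw t (young_diagram lam) {1..n}"
    using finite_same_card_bij[OF finite_young_diagram, of "{1..n}"] by auto
  then show ?thesis by (auto simp: tableaux_def)
qed

lemma inv_into_cong: "(\<And>x. x \<in> D \<Longrightarrow> f x = g x) \<Longrightarrow> inv_into D f = inv_into D g"
  by (auto simp: inv_into_def fun_eq_iff cong: conj_cong)

text \<open>Tableaux are total functions with arbitrary values off the diagram, so they need not be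
  finite in number; a polytabloid depends only on the restriction to the diagram.\<close>

lemma finite_polytabloids: "finite (polytabloid n lam ` tableaux n lam)"
proof -
  let ?D = "young_diagram lam"
  have "polytabloid n lam t = polytabloid n lam (restrict t ?D)" for t
  proof -
    have "inv_into ?D (f \<circ> t) = inv_into ?D (f \<circ> restrict t ?D)" for f :: "nat \<Rightarrow> nat"
      by (rule inv_into_cong) simp
    moreover have "inv_into ?D t = inv_into ?D (restrict t ?D)"
      by (rule inv_into_cong) simp
    ultimately show ?thesis
      unfolding polytabloid_def tabloid_of_def column_stabilizer_def by (simp only:)
  qed
  moreover have "restrict t ?D \<in> ?D \<rightarrow>\<^sub>E {1..n}" if "t \<in> tableaux n lam" for t
    using that by (auto simp: tableaux_def bij_betw_def)
  ultimately have "polytabloid n lam ` tableaux n lam \<subseteq> polytabloid n lam ` (?D \<rightarrow>\<^sub>E {1..n})"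
    by blast
  then show ?thesis
    by (rule finite_subset) (intro finite_imageI finite_PiE finite_young_diagram, simp)
qed

text \<open>The choice behind \<open>specht_basis\<close> ranges over lists, so a finite basis must
  exist: one is extracted from the finite set of polytabloids.\<close>

lemma specht_basis_props:
  shows "distinct (specht_basis n lam)"
    and "fv.independent (set (specht_basis n lam))"
    and "fv.span (set (specht_basis n lam)) = specht_space n lam"
proof -
  let ?G = "polytabloid n lam ` tableaux n lam"
  obtain B where B: "B \<subseteq> ?G" "fv.independent B" "?G \<subseteq> fv.span B"
    by (rule fv.maximal_independent_subset)
  have "fv.span B = specht_space n lam"
    unfolding specht_space_def using B(1,3) by (metis fv.span_eq fv.span_superset order_trans)
  moreover obtain bs where "distinct bs" "set bs = B"
    using finite_distinct_list[OF finite_subset[OF B(1) finite_polytabloids]] by blast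
  ultimately have "\<exists>bs. distinct bs \<and> fv.independent (set bs) \<and> fv.span (set bs) = specht_space n lam"
    using B(2) by blast
  from someI_ex[OF this]
  show "distinct (specht_basis n lam)" "fv.independent (set (specht_basis n lam))"
    "fv.span (set (specht_basis n lam)) = specht_space n lam"
    unfolding specht_basis_def by blast+
qed

text \<open>A polytabloid has coefficient 1 at its own tabloid. Positivity allows the division by
  the dimension in \<open>W\<close>.\<close>

lemma specht_dim_pos:
  assumes "is_partition n lam"
  shows "0 < length (specht_basis n lam)"
proof -
  obtain t where t: "t \<in> tableaux n lam" using tableaux_nonempty[OF assms] by blast
  have "polytabloid n lam t (tabloid_of n lam t) = 1"
    using polytabloid_vec_self[OF young_shape_tableau[OF assms t]] by (simp add: polytabloid_eq_vec[OF t])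
  then have "polytabloid n lam t \<noteq> 0" by (auto simp: zero_fun_def)
  moreover have "polytabloid n lam t \<in> fv.span (set (specht_basis n lam))"
    unfolding specht_basis_props(3) specht_space_def using t by (intro fv.span_base) simp
  ultimately show ?thesis by (auto simp: fv.span_empty)
qed

text \<open>The weighted sum of the operators is a scalar, so each diagonal coordinate equals that
  scalar in whatever basis was chosen.\<close>

lemma specht_character_cycle_sum:
  fixes y :: complex
  assumes part: "is_partition n lam"
  shows "(\<Sum>\<sigma> | \<sigma> permutes {1..n}. mat_trace (specht_rep n lam \<sigma>) * y ^ num_cycles n \<sigma>) =
         of_nat (length (specht_basis n lam)) * content_poly lam y"
proof -
  define bs where "bs = specht_basis n lam"
  let ?P = "{\<sigma>. \<sigma> permutes {1..n}}" and ?N = "length bs"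
  note bs = specht_basis_props[of n lam, folded bs_def]
  have inS: "bs ! i \<in> specht_space n lam" if "i < ?N" for i
    using that bs(3) fv.span_base[of "bs ! i" "set bs"] by simp
  have inspan: "fscale (y ^ ncycles {1..n} \<sigma>) (perm_action (Hilbert_Choice.inv \<sigma>) (bs ! i)) \<in> fv.span (set bs)"
    if "i < ?N" "\<sigma> \<in> ?P" for i \<sigma>
    unfolding bs(3) using perm_action_specht_space[OF permutes_inv inS[OF that(1)]] that(2)
    by (auto simp: specht_space_def intro: fv.span_scale)
  have trace: "mat_trace (specht_rep n lam \<sigma>) =
      (\<Sum>i<?N. fv.representation (set bs) (perm_action (Hilbert_Choice.inv \<sigma>) (bs ! i)) (bs ! i))" for \<sigma>
    by (simp add: mat_trace_def specht_rep_def Let_def bs_def)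
  have "(\<Sum>\<sigma>\<in>?P. mat_trace (specht_rep n lam \<sigma>) * y ^ num_cycles n \<sigma>) =
      (\<Sum>i<?N. \<Sum>\<sigma>\<in>?P. y ^ ncycles {1..n} \<sigma> *
         fv.representation (set bs) (perm_action (Hilbert_Choice.inv \<sigma>) (bs ! i)) (bs ! i))"
    unfolding trace sum_distrib_right num_cycles_eq
    by (subst sum.swap) (simp only: mult.commute)
  also have "\<dots> = (\<Sum>i<?N. content_poly lam y)"
  proof (rule sum.cong[OF refl])
    fix i assume "i \<in> {..<?N}"
    then have i: "i < ?N" by simp
    have b: "bs ! i \<in> set bs" using i by simp
    have "(\<Sum>\<sigma>\<in>?P. y ^ ncycles {1..n} \<sigma> *
         fv.representation (set bs) (perm_action (Hilbert_Choice.inv \<sigma>) (bs ! i)) (bs ! i)) =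
        (\<Sum>\<sigma>\<in>?P. fv.representation (set bs)
           (fscale (y ^ ncycles {1..n} \<sigma>) (perm_action (Hilbert_Choice.inv \<sigma>) (bs ! i))) (bs ! i))"
      using perm_action_specht_space[OF permutes_inv inS[OF i]]
      by (intro sum.cong refl) (simp add: fv.representation_scale[OF bs(2)] bs(3))
    also have "\<dots> = fv.representation (set bs)
        (\<Sum>\<sigma>\<in>?P. fscale (y ^ ncycles {1..n} \<sigma>) (perm_action (Hilbert_Choice.inv \<sigma>) (bs ! i))) (bs ! i)"
      using fv.representation_sum[OF bs(2) inspan[OF i], of ?P "\<lambda>\<sigma>. \<sigma>"] by simp
    also have "\<dots> = fv.representation (set bs) (fscale (content_poly lam y) (bs ! i)) (bs ! i)"
      by (simp only: cycle_sum_specht_space[OF part inS[OF i]])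
    also have "\<dots> = content_poly lam y"
      by (simp add: fv.representation_scale[OF bs(2) fv.span_base[OF b]] fv.representation_basis[OF bs(2) b])
    finally show "(\<Sum>\<sigma>\<in>?P. y ^ ncycles {1..n} \<sigma> *
         fv.representation (set bs) (perm_action (Hilbert_Choice.inv \<sigma>) (bs ! i)) (bs ! i)) =
        content_poly lam y" .
  qed
  finally show ?thesis by (simp add: bs_def)
qed

section \<open>The wreath product\<close>

lemma CHAR_eq_prime:
  assumes "prime p" and "card (UNIV :: 'k::{field, finite} set) = p ^ d"
  shows "CHAR('k) = p"
proof -
  have "prime CHAR('k)"
    using prime_CHAR_semidom[where ?'a = 'k] finite_imp_CHAR_pos[where ?'a = 'k] by simp
  moreover have "CHAR('k) dvd p ^ d" using CHAR_dvd_CARD[where ?'a = 'k] assms(2) by simp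
  ultimately show ?thesis
    using assms(1) by (metis prime_dvd_power primes_dvd_imp_eq)
qed

text \<open>The form that covers multiples of \<open>p\<close>, since the matrix size may be
  divisible by \<open>p\<close>.\<close>

lemma fermat_little: "prime (p::nat) \<Longrightarrow> [a ^ p = a] (mod p)"
proof (cases "p dvd a")
  case True
  assume "prime p"
  then have "p dvd a ^ p" using True by (meson dvd_power_same dvd_trans dvd_power prime_gt_0_nat)
  then show ?thesis using True by (simp add: cong_def)
next
  case False
  assume p: "prime p"
  then have "[a * a ^ (p - 1) = a * 1] (mod p)"
    using False by (intro cong_mult cong_refl fermat_theorem)
  moreover have "a * a ^ (p - 1) = a ^ p"
    using prime_gt_0_nat[OF p] by (cases p) auto
  ultimately show ?thesis by simp
qed

text \<open>Frobenius fixes the prime field, so the field trace is a sum of \<open>d\<close> equal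
  terms. \<open>prime_field_val\<close> then picks the residue modulo \<open>p\<close>, and the
  exponential does not see the multiple of \<open>p\<close> removed.\<close>

lemma add_char_of_nat:
  assumes p: "prime p" and card: "card (UNIV :: 'k::{field, finite} set) = p ^ d"
  shows "add_char p d (of_nat m :: 'k) = exp (2 * pi * \<i> * of_nat (m * d) / of_nat p)"
proof -
  note char = CHAR_eq_prime[OF p card]
  have of_nat_eq: "of_nat a = (of_nat b :: 'k) \<longleftrightarrow> [a = b] (mod p)" for a b
    by (simp add: of_nat_eq_iff_cong_CHAR char)
  have "(of_nat m :: 'k) ^ p ^ i = of_nat m" for i
  proof (induction i)
    case (Suc i)
    have "(of_nat m :: 'k) ^ p ^ Suc i = (of_nat m ^ p ^ i) ^ p"
      by (simp add: mult.commute flip: power_mult)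
    also have "\<dots> = of_nat (m ^ p)" by (simp add: Suc)
    also have "\<dots> = of_nat m" using fermat_little[OF p] by (simp add: of_nat_eq del: of_nat_power)
    finally show ?case .
  qed simp
  then have tr: "field_trace p d (of_nat m :: 'k) = of_nat (m * d)"
    by (simp add: field_trace_def mult.commute)
  define N where "N = m * d"
  have "prime_field_val (of_nat N :: 'k) = N mod p"
    unfolding prime_field_val_def of_nat_eq
  proof (rule Least_equality)
    fix k assume "[k = N] (mod p)"
    then show "N mod p \<le> k" by (metis cong_def mod_less_eq_dividend)
  qed simp
  then have "add_char p d (of_nat m :: 'k) = exp (2 * pi * \<i> * of_nat (N mod p) / of_nat p)"
    by (simp add: add_char_def tr N_def)
  also have "\<dots> = exp (2 * pi * \<i> * of_nat N / of_nat p)"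
  proof -
    have p0: "(of_nat p :: complex) \<noteq> 0" using prime_gt_0_nat[OF p] by simp
    have "(of_nat N :: complex) = of_nat p * of_nat (N div p) + of_nat (N mod p)"
      by (metis mult_div_mod_eq of_nat_add of_nat_mult)
    then have "2 * pi * \<i> * of_nat N / of_nat p =
        of_nat (N div p) * (2 * pi * \<i>) + 2 * pi * \<i> * of_nat (N mod p) / of_nat p"
      using p0 by (simp add: field_simps)
    moreover have "exp (of_nat (N div p) * (2 * of_real pi * \<i>)) = 1"
      by (simp add: exp_of_nat_mult mult.commute)
    ultimately show ?thesis by (simp add: exp_add)
  qed
  finally show ?thesis by (simp add: N_def)
qed

section \<open>Matrix traces and products along a cycle\<close>

lemma mat_trace_mult_commute:
  fixes A B :: "'a::comm_semiring_0 mat"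
  assumes "A \<in> carrier_mat n n" "B \<in> carrier_mat n n"
  shows "mat_trace (A * B) = mat_trace (B * A)"
proof -
  have "mat_trace (A * B) = (\<Sum>i<n. \<Sum>j<n. A $$ (i, j) * B $$ (j, i))"
    using assms by (auto simp: mat_trace_def scalar_prod_def atLeast0LessThan intro!: sum.cong)
  also have "\<dots> = (\<Sum>j<n. \<Sum>i<n. B $$ (j, i) * A $$ (i, j))"
    by (subst sum.swap) (simp add: mult.commute)
  also have "\<dots> = mat_trace (B * A)"
    using assms by (auto simp: mat_trace_def scalar_prod_def atLeast0LessThan intro!: sum.cong)
  finally show ?thesis .
qed

lemma mat_trace_one: "mat_trace (1\<^sub>m m :: 'a::semiring_1 mat) = of_nat m"
  by (simp add: mat_trace_def)

lemma funpow_card_perm_orbit: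
  assumes "permutation \<sigma>"
  shows "(\<sigma> ^^ card (perm_orbit \<sigma> i)) i = i"
proof -
  have "card (perm_orbit \<sigma> i) = least_power \<sigma> i"
    using distinct_card[OF cycle_of_permutation[OF assms, of i]]
    by (simp add: perm_orbit_def support_set[OF assms, of i, symmetric] del: set_map)
  then show ?thesis using least_power_of_permutation(1)[OF assms] by simp
qed

lemma finite_carrier_mat: "finite (carrier_mat m n :: 'a::finite mat set)"
proof -
  let ?S = "{..<m} \<times> {..<n}"
  have "A \<in> (\<lambda>f. mat m n f) ` (?S \<rightarrow>\<^sub>E UNIV)" if "A \<in> carrier_mat m n" for A :: "'a mat"
    using that by (intro image_eqI[where x = "restrict (\<lambda>ij. A $$ ij) ?S"]) auto
  then have "carrier_mat m n \<subseteq> (\<lambda>f. mat m n f) ` (?S \<rightarrow>\<^sub>E (UNIV :: 'a set))" by blast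
  then show ?thesis
    by (rule finite_subset) (intro finite_imageI finite_PiE, auto)
qed

text \<open>\<open>cycle_product\<close> with its length detached from the orbit, so that induction
  on the length is possible.\<close>

definition path_product :: "nat \<Rightarrow> (nat \<Rightarrow> nat) \<Rightarrow> (nat \<Rightarrow> 'k::field mat) \<Rightarrow> nat \<Rightarrow> nat \<Rightarrow> 'k mat" where
  "path_product m \<sigma> \<alpha> r i = foldr (*) (map (\<lambda>k. \<alpha> ((\<sigma> ^^ k) i)) [0..<r]) (1\<^sub>m m)"

lemma path_product_0: "path_product m \<sigma> \<alpha> 0 i = 1\<^sub>m m"
  by (simp add: path_product_def)

lemma path_product_Suc: "path_product m \<sigma> \<alpha> (Suc r) i = \<alpha> i * path_product m \<sigma> \<alpha> r (\<sigma> i)"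
proof -
  have "[0..<Suc r] = 0 # map Suc [0..<r]" by (simp add: upt_conv_Cons map_Suc_upt del: upt_Suc)
  then show ?thesis by (simp add: path_product_def o_def funpow_swap1 del: upt_Suc)
qed

lemma path_product_carrier:
  assumes "\<And>i. \<alpha> i \<in> carrier_mat m m"
  shows "path_product m \<sigma> \<alpha> r i \<in> carrier_mat m m"
  by (induction r arbitrary: i)
     (auto simp: path_product_0 path_product_Suc intro!: mult_carrier_mat[OF assms])

text \<open>The hypotheses are the components of \<open>t Y = X t\<close> with \<open>t\<close>
  given by \<open>\<tau>\<close> and \<open>\<beta>\<close>; \<open>\<beta>\<close> is pushed
  through one factor at a time. Around a full cycle it returns to its starting index, and the
  relation becomes a conjugation.\<close>

lemma path_product_intertwine:
  assumes c: "\<And>i. \<alpha> i \<in> carrier_mat m m" "\<And>i. \<alpha>' i \<in> carrier_mat m m" "\<And>i. \<beta> i \<in> carrier_mat m m"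
    and \<sigma>: "\<And>i. \<sigma>' (\<tau> i) = \<tau> (\<sigma> i)" and eq: "\<And>i. \<beta> i * \<alpha>' (\<tau> i) = \<alpha> i * \<beta> (\<sigma> i)"
  shows "\<beta> i * path_product m \<sigma>' \<alpha>' r (\<tau> i) = path_product m \<sigma> \<alpha> r i * \<beta> ((\<sigma> ^^ r) i)"
proof (induction r arbitrary: i)
  case 0
  then show ?case using c(3)[of i] by (simp add: path_product_0)
next
  case (Suc r)
  note pc = path_product_carrier[of \<alpha> m, OF c(1)] path_product_carrier[of \<alpha>' m, OF c(2)]
  have "\<beta> i * path_product m \<sigma>' \<alpha>' (Suc r) (\<tau> i) =
      (\<beta> i * \<alpha>' (\<tau> i)) * path_product m \<sigma>' \<alpha>' r (\<tau> (\<sigma> i))"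
    unfolding path_product_Suc \<sigma> by (rule assoc_mult_mat[symmetric]) (rule c pc)+
  also have "\<dots> = \<alpha> i * (\<beta> (\<sigma> i) * path_product m \<sigma>' \<alpha>' r (\<tau> (\<sigma> i)))"
    unfolding eq by (rule assoc_mult_mat) (rule c pc)+
  also have "\<dots> = \<alpha> i * (path_product m \<sigma> \<alpha> r (\<sigma> i) * \<beta> ((\<sigma> ^^ r) (\<sigma> i)))"
    unfolding Suc ..
  also have "\<dots> = \<alpha> i * path_product m \<sigma> \<alpha> r (\<sigma> i) * \<beta> ((\<sigma> ^^ r) (\<sigma> i))"
    by (rule assoc_mult_mat[symmetric]) (rule c pc)+
  also have "(\<sigma> ^^ r) (\<sigma> i) = (\<sigma> ^^ Suc r) i" by (simp add: funpow_swap1)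
  finally show ?case by (simp only: path_product_Suc)
qed

section \<open>The wreath product as a group, and class functions on it\<close>

context
  fixes n m :: nat and H :: "'k::field mat set"
  assumes H: "is_GL_subgroup m H"
begin

lemma GL_carrier: "A \<in> H \<Longrightarrow> A \<in> carrier_mat m m"
  using H by (auto simp: is_GL_subgroup_def)

lemma GL_inverse:
  assumes "A \<in> H"
  obtains B where "B \<in> H" "A * B = 1\<^sub>m m" "B * A = 1\<^sub>m m"
  using H assms mat_mult_left_right_inverse GL_carrier unfolding is_GL_subgroup_def by metis

lemma wreath_permutes: "X \<in> wreath n m H \<Longrightarrow> fst X permutes {1..n}"
  by (auto simp: wreath_def)

lemma wreath_in_H: "X \<in> wreath n m H \<Longrightarrow> snd X i \<in> H"
  using H by (cases "i \<in> {1..n}") (auto simp: wreath_def is_GL_subgroup_def)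

lemma wreath_outside: "X \<in> wreath n m H \<Longrightarrow> i \<notin> {1..n} \<Longrightarrow> snd X i = 1\<^sub>m m"
  by (auto simp: wreath_def)

lemma wreathI:
  "\<sigma> permutes {1..n} \<Longrightarrow> (\<And>i. \<alpha> i \<in> H) \<Longrightarrow> (\<And>i. i \<notin> {1..n} \<Longrightarrow> \<alpha> i = 1\<^sub>m m) \<Longrightarrow>
    (\<sigma>, \<alpha>) \<in> wreath n m H"
  by (simp add: wreath_def)

lemma fst_wr_mult: "fst (wr_mult n m X Y) = fst Y \<circ> fst X"
  by (simp add: wr_mult_def split: prod.split)

text \<open>The case distinction of \<open>wr_mult\<close> disappears because outside
  \<open>{1..n}\<close> both factors are the identity matrix.\<close>

lemma snd_wr_mult:
  assumes "X \<in> wreath n m H" "Y \<in> wreath n m H"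
  shows "snd (wr_mult n m X Y) i = snd X i * snd Y (fst X i)"
proof (cases "i \<in> {1..n}")
  case False
  then have "fst X i \<notin> {1..n}" using permutes_in_image[OF wreath_permutes[OF assms(1)]] by blast
  then show ?thesis
    using False wreath_outside[OF assms(1) False] wreath_outside[OF assms(2), of "fst X i"]
    by (auto simp: wr_mult_def split: prod.split)
qed (simp add: wr_mult_def split: prod.split)

lemma wr_mult_closed:
  assumes X: "X \<in> wreath n m H" and Y: "Y \<in> wreath n m H"
  shows "wr_mult n m X Y \<in> wreath n m H"
proof -
  have "(fst (wr_mult n m X Y), snd (wr_mult n m X Y)) \<in> wreath n m H"
  proof (rule wreathI)
    show "fst (wr_mult n m X Y) permutes {1..n}"
      unfolding fst_wr_mult by (intro permutes_compose wreath_permutes X Y)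
    show "snd (wr_mult n m X Y) i \<in> H" for i
      unfolding snd_wr_mult[OF X Y] using wreath_in_H[OF X] wreath_in_H[OF Y] H
      by (simp add: is_GL_subgroup_def)
    show "snd (wr_mult n m X Y) i = 1\<^sub>m m" if "i \<notin> {1..n}" for i
      using that by (auto simp: wr_mult_def split: prod.split)
  qed
  then show ?thesis by simp
qed

lemma wr_one_closed: "wr_one m \<in> wreath n m H"
  unfolding wr_one_def using H by (intro wreathI) (auto simp: is_GL_subgroup_def)

definition wreath_group :: "'k wr_elem monoid" where
  "wreath_group = \<lparr>carrier = wreath n m H, monoid.mult = wr_mult n m, one = wr_one m\<rparr>"

lemma wreath_group_simps:
  "carrier wreath_group = wreath n m H"
  "monoid.mult wreath_group = wr_mult n m"
  "one wreath_group = wr_one m"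
  by (simp_all add: wreath_group_def)

lemma wreath_carrier: "X \<in> wreath n m H \<Longrightarrow> snd X i \<in> carrier_mat m m"
  by (intro GL_carrier wreath_in_H)

lemma wr_elem_eqI:
  "fst X = fst Y \<Longrightarrow> (\<And>i. snd X i = snd Y i) \<Longrightarrow> (X :: 'k wr_elem) = Y"
  by (auto simp: prod_eq_iff)

lemma group_wreath: "group wreath_group"
proof (rule groupI, unfold wreath_group_simps)
  fix X Y Z assume X: "X \<in> wreath n m H" and Y: "Y \<in> wreath n m H" and Z: "Z \<in> wreath n m H"
  note c = wreath_carrier[OF X] wreath_carrier[OF Y] wreath_carrier[OF Z]
  show "wr_mult n m (wr_mult n m X Y) Z = wr_mult n m X (wr_mult n m Y Z)"
  proof (rule wr_elem_eqI)
    fix i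
    show "snd (wr_mult n m (wr_mult n m X Y) Z) i = snd (wr_mult n m X (wr_mult n m Y Z)) i"
      unfolding snd_wr_mult[OF wr_mult_closed[OF X Y] Z] snd_wr_mult[OF X Y]
        snd_wr_mult[OF X wr_mult_closed[OF Y Z]] snd_wr_mult[OF Y Z] fst_wr_mult comp_apply
      by (rule assoc_mult_mat[OF c])
  qed (simp add: fst_wr_mult o_assoc)
next
  fix X assume X: "X \<in> wreath n m H"
  show "wr_mult n m (wr_one m) X = X"
  proof (rule wr_elem_eqI)
    show "snd (wr_mult n m (wr_one m) X) i = snd X i" for i
      unfolding snd_wr_mult[OF wr_one_closed X] using wreath_carrier[OF X, of i]
      by (simp add: wr_one_def)
  qed (simp add: fst_wr_mult wr_one_def)
  define iv where "iv A = (SOME B. B \<in> H \<and> A * B = 1\<^sub>m m \<and> B * A = 1\<^sub>m m)" for A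
  have iv: "iv A \<in> H \<and> A * iv A = 1\<^sub>m m \<and> iv A * A = 1\<^sub>m m" if "A \<in> H" for A
    unfolding iv_def by (rule someI_ex) (rule GL_inverse[OF that], blast)
  let ?s = "Hilbert_Choice.inv (fst X)"
  \<comment> \<open>In \<open>Y X\<close> the component \<open>i\<close> of \<open>Y\<close> is
    multiplied by \<open>snd X (?s i)\<close>, so it must be the inverse of that matrix.\<close>
  define Y where "Y = (?s, \<lambda>i. if i \<in> {1..n} then iv (snd X (?s i)) else 1\<^sub>m m)"
  have Y: "Y \<in> wreath n m H"
    unfolding Y_def using iv[OF wreath_in_H[OF X]] H
    by (intro wreathI permutes_inv wreath_permutes[OF X]) (auto simp: is_GL_subgroup_def)
  have "wr_mult n m Y X = wr_one m"
  proof (rule wr_elem_eqI)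
    show "fst (wr_mult n m Y X) = fst (wr_one m)"
      by (simp add: fst_wr_mult Y_def wr_one_def permutes_inv_o[OF wreath_permutes[OF X]])
    fix i
    show "snd (wr_mult n m Y X) i = snd (wr_one m) i"
    proof (cases "i \<in> {1..n}")
      case True
      then show ?thesis unfolding snd_wr_mult[OF Y X]
        using iv[OF wreath_in_H[OF X]] by (simp add: Y_def wr_one_def)
    next
      case False
      then show ?thesis using wreath_outside[OF wr_mult_closed[OF Y X]] by (simp add: wr_one_def)
    qed
  qed
  then show "\<exists>Y\<in>wreath n m H. wr_mult n m Y X = wr_one m" using Y by blast
qed (simp_all add: wr_mult_closed wr_one_closed)

lemma wr_inv_eq:
  assumes "X \<in> wreath n m H"
  shows "wr_inv n m H X = m_inv wreath_group X"
proof -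
  interpret group wreath_group by (rule group_wreath)
  have X: "X \<in> carrier wreath_group" using assms by (simp add: wreath_group_simps)
  show ?thesis
    unfolding wr_inv_def
  proof (rule the_equality)
    show "m_inv wreath_group X \<in> wreath n m H \<and> wr_mult n m X (m_inv wreath_group X) = wr_one m"
      using inv_closed[OF X] r_inv[OF X] by (simp add: wreath_group_simps)
    fix Y assume "Y \<in> wreath n m H \<and> wr_mult n m X Y = wr_one m"
    then show "Y = m_inv wreath_group X"
      using inv_equality[of Y X] X inv_comm[of X Y] by (simp add: wreath_group_simps)
  qed
qed

text \<open>The two cycle products are conjugate by the component \<open>snd t i\<close>, which is
  invertible.\<close>

lemma mat_trace_cycle_product_conj:
  assumes X: "X \<in> wreath n m H" and Y: "Y \<in> wreath n m H" and t: "t \<in> wreath n m H"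
    and eq: "wr_mult n m t Y = wr_mult n m X t"
  shows "mat_trace (cycle_product m (fst Y) (snd Y) (fst t i)) =
         mat_trace (cycle_product m (fst X) (snd X) i)"
proof -
  let ?r = "card (perm_orbit (fst X) i)"
  let ?P = "path_product m (fst X) (snd X) ?r i"
  let ?Q = "path_product m (fst Y) (snd Y) ?r (fst t i)"
  note c = wreath_carrier[OF X] wreath_carrier[OF Y] wreath_carrier[OF t]
  have \<sigma>: "fst Y (fst t k) = fst t (fst X k)" for k
    using arg_cong[OF eq, of fst] by (simp add: fst_wr_mult fun_eq_iff)
  have \<alpha>: "snd t k * snd Y (fst t k) = snd X k * snd t (fst X k)" for k
    using arg_cong[OF eq, of "\<lambda>Z. snd Z k"] by (simp only: snd_wr_mult[OF t Y] snd_wr_mult[OF X t])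
  have P: "?P \<in> carrier_mat m m" and Q: "?Q \<in> carrier_mat m m"
    by (intro path_product_carrier c)+
  have "permutation (fst X)"
    using permutes_imp_permutation[OF _ wreath_permutes[OF X]] by simp
  then have "(fst X ^^ ?r) i = i" by (rule funpow_card_perm_orbit)
  then have tQ: "snd t i * ?Q = ?P * snd t i"
    using path_product_intertwine[of "snd X" m "snd Y" "snd t" "fst Y" "fst t" "fst X", OF c \<sigma> \<alpha>, of i ?r]
    by simp
  have ct: "snd t i \<in> carrier_mat m m" by (rule c)
  obtain B where B: "B \<in> H" "snd t i * B = 1\<^sub>m m" "B * snd t i = 1\<^sub>m m"
    by (rule GL_inverse[OF wreath_in_H[OF t]])
  have cB: "B \<in> carrier_mat m m" by (rule GL_carrier[OF B(1)])
  have "?Q = (B * snd t i) * ?Q" using Q by (simp add: B(3))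
  also have "\<dots> = B * (?P * snd t i)"
    unfolding tQ[symmetric] by (rule assoc_mult_mat[OF cB ct Q])
  finally have "mat_trace ?Q = mat_trace (?P * snd t i * B)"
    using mat_trace_mult_commute[OF cB mult_carrier_mat[OF P ct]] by simp
  also have "?P * snd t i * B = ?P"
    using assoc_mult_mat[OF P ct cB] P by (simp add: B(2))
  finally have "mat_trace ?Q = mat_trace ?P" .
  moreover have "card (perm_orbit (fst Y) (fst t i)) = ?r"
    unfolding perm_orbit_conj[of "fst Y" "fst t" "fst X", OF \<sigma>]
    by (intro card_image permutes_inj_on[OF wreath_permutes[OF t]])
  ultimately show ?thesis by (simp add: cycle_product_def path_product_def)
qed

text \<open>\<open>X\<close> commutes with itself, so the conjugation lemma with
  \<open>t = Y = X\<close> moves the starting point one step along its cycle.\<close>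

lemma mat_trace_cycle_product_orbit:
  assumes X: "X \<in> wreath n m H" and j: "j \<in> perm_orbit (fst X) i"
  shows "mat_trace (cycle_product m (fst X) (snd X) j) = mat_trace (cycle_product m (fst X) (snd X) i)"
proof -
  have "perm_orbit (fst X) i \<subseteq>
      {j. mat_trace (cycle_product m (fst X) (snd X) j) = mat_trace (cycle_product m (fst X) (snd X) i)}"
    by (rule perm_orbit_least) (simp_all add: mat_trace_cycle_product_conj[OF X X X refl])
  then show ?thesis using j by blast
qed

text \<open>\<open>Lambda\<close> starts each cycle at its minimum, and relabelling by a permutation
  need not preserve minima; this frees the starting point.\<close>

lemma mat_trace_cycle_product_Min:
  assumes X: "X \<in> wreath n m H" and i: "i \<in> {1..n}"
  shows "mat_trace (cycle_product m (fst X) (snd X) (Min (perm_orbit (fst X) i))) =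
         mat_trace (cycle_product m (fst X) (snd X) i)"
proof (rule mat_trace_cycle_product_orbit[OF X], rule Min_in)
  show "finite (perm_orbit (fst X) i)"
    using perm_orbit_subset[OF wreath_permutes[OF X] i] finite_subset by blast
  show "perm_orbit (fst X) i \<noteq> {}" using perm_orbit_self by blast
qed

lemma Lambda_conj:
  assumes X: "X \<in> wreath n m H" and Y: "Y \<in> wreath n m H" and t: "t \<in> wreath n m H"
    and eq: "wr_mult n m t Y = wr_mult n m X t"
  shows "Lambda p d n m Y = Lambda p d n m X"
proof -
  let ?g = "\<lambda>X C. add_char p d (mat_trace (cycle_product m (fst X) (snd X) (Min C)))"
  have L: "Lambda p d n m Z = (\<Prod>C\<in>perm_orbit (fst Z) ` {1..n}. ?g Z C)" for Z :: "'k wr_elem"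
    by (simp add: Lambda_def perm_cycles_def split: prod.split)
  have \<sigma>: "fst Y (fst t k) = fst t (fst X k)" for k
    using arg_cong[OF eq, of fst] by (simp add: fst_wr_mult fun_eq_iff)
  have tp: "fst t permutes {1..n}" by (rule wreath_permutes[OF t])
  have "inj (\<lambda>C. fst t ` C)"
    by (intro injI) (simp add: inj_image_eq_iff[OF permutes_inj[OF tp]])
  then have inj: "inj_on (\<lambda>C. fst t ` C) (perm_orbit (fst X) ` {1..n})"
    by (rule inj_on_subset) simp
  have "Lambda p d n m Y = (\<Prod>C\<in>perm_orbit (fst X) ` {1..n}. ?g Y (fst t ` C))"
    unfolding L perm_cycles_conj[of "fst t" "{1..n}" "fst Y" "fst X", OF tp \<sigma>]
    by (simp only: prod.reindex[OF inj] comp_def)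
  also have "\<dots> = Lambda p d n m X"
    unfolding L
  proof (rule prod.cong[OF refl])
    fix C assume "C \<in> perm_orbit (fst X) ` {1..n}"
    then obtain i where i: "i \<in> {1..n}" "C = perm_orbit (fst X) i" by blast
    have ti: "fst t i \<in> {1..n}" using i(1) permutes_in_image[OF tp] by blast
    have "fst t ` C = perm_orbit (fst Y) (fst t i)"
      unfolding i(2) by (rule perm_orbit_conj[of "fst Y" "fst t" "fst X", OF \<sigma>, symmetric])
    then show "?g Y (fst t ` C) = ?g X C"
      using mat_trace_cycle_product_Min[OF Y ti] mat_trace_cycle_product_Min[OF X i(1)]
        mat_trace_cycle_product_conj[OF X Y t eq, of i]
      by (simp add: i(2))
  qed
  finally show ?thesis .
qed

lemma psi_conj:
  assumes t: "t \<in> wreath n m H" and eq: "wr_mult n m t Y = wr_mult n m X t"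
  shows "psi n x (fst Y) = psi n x (fst X)"
proof -
  have "fst Y (fst t k) = fst t (fst X k)" for k
    using arg_cong[OF eq, of fst] by (simp add: fst_wr_mult fun_eq_iff)
  then have "ncycles {1..n} (fst Y) = ncycles {1..n} (fst X)"
    by (rule ncycles_conj[OF wreath_permutes[OF t]])
  then show ?thesis by (simp add: psi_def num_cycles_eq)
qed

lemma sym_in_wreath_subset: "sym_in_wreath n m \<subseteq> wreath n m H"
  using H by (auto simp: sym_in_wreath_def is_GL_subgroup_def intro!: wreathI)

lemma finite_wreath:
  assumes "finite H"
  shows "finite (wreath n m H)"
proof -
  have "wreath n m H \<subseteq> {\<sigma>. \<sigma> permutes {1..n}} \<times>
      {\<alpha>. \<forall>i. (i \<in> {1..n} \<longrightarrow> \<alpha> i \<in> H) \<and> (i \<notin> {1..n} \<longrightarrow> \<alpha> i = 1\<^sub>m m)}"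
    by (auto simp: wreath_def)
  then show ?thesis
    by (rule finite_subset)
       (intro finite_cartesian_product finite_permutations finite_set_of_finite_funs assms, auto)
qed

text \<open>The elements with trivial permutation part represent the cosets: \<open>g\<close>
  factors uniquely as \<open>(id, snd g)\<close> times the permutation \<open>fst g\<close> with
  identity matrices.\<close>

lemma wreath_transversal:
  assumes "finite H"
  shows "\<exists>ts. set ts \<subseteq> wreath n m H \<and> (\<forall>g\<in>wreath n m H.
     \<exists>!i. i < length ts \<and> wr_mult n m (wr_inv n m H (ts ! i)) g \<in> sym_in_wreath n m)"
proof -
  interpret G: group wreath_group by (rule group_wreath)
  have "finite {X \<in> wreath n m H. fst X = id}" using finite_wreath[OF assms] by simp
  then obtain ts where ts: "distinct ts" "set ts = {X \<in> wreath n m H. fst X = id}"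
    using finite_distinct_list by blast
  have key: "wr_mult n m (wr_inv n m H u) g \<in> sym_in_wreath n m \<longleftrightarrow> u = (id, snd g)"
    if g: "g \<in> wreath n m H" and u: "u \<in> wreath n m H" "fst u = id" for g u
  proof -
    have c: "u \<in> carrier wreath_group" "g \<in> carrier wreath_group"
      using g u by (simp_all add: wreath_group_simps)
    have solve: "k = wr_mult n m (wr_inv n m H u) g \<longleftrightarrow> g = wr_mult n m u k"
      if "k \<in> wreath n m H" for k
    proof -
      have k: "k \<in> carrier wreath_group" using that by (simp add: wreath_group_simps)
      show ?thesis
        using G.inv_solve_left[OF k c] unfolding wreath_group_simps wr_inv_eq[OF u(1)] .
    qed
    have mult: "wr_mult n m u (\<sigma>, \<lambda>i. 1\<^sub>m m) = (\<sigma>, snd u)" if "\<sigma> permutes {1..n}" for \<sigma>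
    proof (rule wr_elem_eqI)
      have k: "(\<sigma>, \<lambda>i. 1\<^sub>m m) \<in> wreath n m H"
        using that sym_in_wreath_subset by (auto simp: sym_in_wreath_def)
      show "snd (wr_mult n m u (\<sigma>, \<lambda>i. 1\<^sub>m m)) i = snd (\<sigma>, snd u) i" for i
        unfolding snd_wr_mult[OF u(1) k] using wreath_carrier[OF u(1), of i] by simp
    qed (simp add: fst_wr_mult u)
    show ?thesis
    proof
      assume K: "wr_mult n m (wr_inv n m H u) g \<in> sym_in_wreath n m"
      then obtain \<sigma> where \<sigma>: "\<sigma> permutes {1..n}" "(\<sigma>, \<lambda>i. 1\<^sub>m m) = wr_mult n m (wr_inv n m H u) g"
        by (auto simp: sym_in_wreath_def)
      then have "g = wr_mult n m u (\<sigma>, \<lambda>i. 1\<^sub>m m)"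
        using solve[of "(\<sigma>, \<lambda>i. 1\<^sub>m m)"] K sym_in_wreath_subset by auto
      then have "g = (\<sigma>, snd u)" by (simp only: mult[OF \<sigma>(1)])
      then show "u = (id, snd g)" using u(2) by (simp add: prod_eq_iff)
    next
      assume u': "u = (id, snd g)"
      have gp: "fst g permutes {1..n}" by (rule wreath_permutes[OF g])
      have K: "(fst g, \<lambda>i. 1\<^sub>m m) \<in> sym_in_wreath n m" using gp by (auto simp: sym_in_wreath_def)
      have "g = wr_mult n m u (fst g, \<lambda>i. 1\<^sub>m m)"
        unfolding mult[OF gp] using u' by (simp add: prod_eq_iff)
      then show "wr_mult n m (wr_inv n m H u) g \<in> sym_in_wreath n m"
        using solve[of "(fst g, \<lambda>i. 1\<^sub>m m)"] K sym_in_wreath_subset by auto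
    qed
  qed
  have "\<exists>!i. i < length ts \<and> wr_mult n m (wr_inv n m H (ts ! i)) g \<in> sym_in_wreath n m"
    if g: "g \<in> wreath n m H" for g
  proof -
    have "(id, snd g) \<in> wreath n m H"
      using wreath_in_H[OF g] wreath_outside[OF g] by (intro wreathI permutes_id)
    then have "(id, snd g) \<in> set ts" by (simp add: ts(2))
    then have "\<exists>!i. i < length ts \<and> ts ! i = (id, snd g)"
      using ts(1) by (metis distinct_Ex1)
    moreover have "wr_mult n m (wr_inv n m H (ts ! i)) g \<in> sym_in_wreath n m \<longleftrightarrow> ts ! i = (id, snd g)"
      if "i < length ts" for i
      using key[OF g, of "ts ! i"] nth_mem[OF that] ts(2) by auto
    ultimately show ?thesis by (metis (no_types, lifting))
  qed
  then show ?thesis using ts(2) by (intro exI[of _ ts]) auto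
qed

end

text \<open>The trace of an induced matrix is a sum over diagonal blocks, one for each
  representative \<open>t\<close>, and replacing \<open>X\<close> by its conjugate under
  \<open>t\<close> reduces every block to the same sum over \<open>K\<close>. The class function
  property is stated as \<open>t Y = X t\<close>, the form that \<open>psi_conj\<close> and
  \<open>Lambda_conj\<close> deliver.\<close>

lemma induced_character_sum:
  fixes G (structure) and F :: "'g \<Rightarrow> complex" and \<rho> :: "'g \<Rightarrow> complex mat"
  assumes G: "group G" and fin: "finite (carrier G)" and K: "K \<subseteq> carrier G"
    and ginv: "\<And>t. t \<in> carrier G \<Longrightarrow> ginv t = m_inv G t"
    and trans: "\<exists>ts. set ts \<subseteq> carrier G \<and>
       (\<forall>g\<in>carrier G. \<exists>!i. i < length ts \<and> mult G (ginv (ts ! i)) g \<in> K)"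
    and dim: "\<And>k. k \<in> K \<Longrightarrow> dim_row (\<rho> k) = N"
    and F: "\<And>t X Y. t \<in> carrier G \<Longrightarrow> X \<in> carrier G \<Longrightarrow> Y \<in> carrier G \<Longrightarrow>
       mult G t Y = mult G X t \<Longrightarrow> F Y = F X"
  shows "(\<Sum>X\<in>carrier G. mat_trace (induced_rep (mult G) ginv (carrier G) K \<rho> N X) * F X) =
      of_nat (length (left_transversal (mult G) ginv (carrier G) K)) * (\<Sum>Y\<in>K. mat_trace (\<rho> Y) * F Y)"
    and "0 < length (left_transversal (mult G) ginv (carrier G) K)"
proof -
  interpret group G by (rule G)
  define ts where "ts = left_transversal (mult G) ginv (carrier G) K"
  have "set ts \<subseteq> carrier G \<and>
       (\<forall>g\<in>carrier G. \<exists>!i. i < length ts \<and> mult G (ginv (ts ! i)) g \<in> K)"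
    unfolding ts_def left_transversal_def by (rule someI_ex[OF trans])
  then have sub: "set ts \<subseteq> carrier G"
    and ex: "\<exists>!i. i < length ts \<and> mult G (ginv (ts ! i)) \<one> \<in> K" by auto
  show "0 < length (left_transversal (mult G) ginv (carrier G) K)"
    using ex unfolding ts_def by (metis less_nat_zero_code neq0_conv)
  have tG: "ts ! a \<in> carrier G" if "a < length ts" for a using sub that by auto
  define cj where "cj t X = m_inv G t \<otimes> X \<otimes> t" for t X
  have trace: "mat_trace (induced_rep (mult G) ginv (carrier G) K \<rho> N X) =
      (\<Sum>a<length ts. if cj (ts ! a) X \<in> K then mat_trace (\<rho> (cj (ts ! a) X)) else 0)" for X
  proof -
    let ?f = "\<lambda>r. let y = ginv (ts ! (r div N)) \<otimes> X \<otimes> ts ! (r div N) in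
        if y \<in> K then \<rho> y $$ (r mod N, r mod N) else 0"
    have "mat_trace (induced_rep (mult G) ginv (carrier G) K \<rho> N X) = (\<Sum>r<length ts * N. ?f r)"
      by (simp add: mat_trace_def induced_rep_def ts_def Let_def)
    \<comment> \<open>A diagonal index is \<open>a * N + b\<close>, with block \<open>a\<close> and
      position \<open>b\<close> inside it.\<close>
    also have "\<dots> = (\<Sum>a<length ts. \<Sum>r\<in>{a * N..<a * N + N}. ?f r)"
      by (rule sum.nat_group[symmetric])
    also have "\<dots> = (\<Sum>a<length ts. if cj (ts ! a) X \<in> K then mat_trace (\<rho> (cj (ts ! a) X)) else 0)"
    proof (rule sum.cong[OF refl])
      fix a assume "a \<in> {..<length ts}"
      then have a: "a < length ts" by simp
      have "(\<Sum>r\<in>{a * N..<a * N + N}. ?f r) = (\<Sum>b<N. ?f (a * N + b))"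
        by (rule sum.reindex_bij_witness[where i = "\<lambda>b. a * N + b" and j = "\<lambda>r. r - a * N"])
           (auto simp: Let_def)
      also have "\<dots> = (\<Sum>b<N. if cj (ts ! a) X \<in> K then \<rho> (cj (ts ! a) X) $$ (b, b) else 0)"
        by (rule sum.cong[OF refl]) (simp add: ginv[OF tG[OF a]] cj_def)
      also have "\<dots> = (if cj (ts ! a) X \<in> K then mat_trace (\<rho> (cj (ts ! a) X)) else 0)"
        by (simp add: mat_trace_def dim)
      finally show "(\<Sum>r\<in>{a * N..<a * N + N}. ?f r) =
          (if cj (ts ! a) X \<in> K then mat_trace (\<rho> (cj (ts ! a) X)) else 0)" .
    qed
    finally show ?thesis .
  qed
  have conj: "(\<Sum>X\<in>carrier G. (if cj t X \<in> K then mat_trace (\<rho> (cj t X)) else 0) * F X) =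
      (\<Sum>Y\<in>K. mat_trace (\<rho> Y) * F Y)" if t: "t \<in> carrier G" for t
  proof -
    have it: "m_inv G t \<in> carrier G" using t by simp
    have c1: "t \<otimes> (m_inv G t \<otimes> X) = X" and c2: "m_inv G t \<otimes> (t \<otimes> X) = X" if "X \<in> carrier G" for X
      using t that by (simp_all add: m_assoc[symmetric])
    have "(\<Sum>X\<in>carrier G. (if cj t X \<in> K then mat_trace (\<rho> (cj t X)) else 0) * F X) =
        (\<Sum>Y\<in>carrier G. (if Y \<in> K then mat_trace (\<rho> Y) else 0) * F Y)"
    proof (rule sum.reindex_bij_witness[where i = "\<lambda>Y. t \<otimes> Y \<otimes> m_inv G t" and j = "cj t"])
      fix X assume X: "X \<in> carrier G"
      show cX: "cj t X \<in> carrier G" using t X by (simp add: cj_def)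
      show "t \<otimes> X \<otimes> m_inv G t \<in> carrier G" using t X by simp
      show "t \<otimes> cj t X \<otimes> m_inv G t = X" "cj t (t \<otimes> X \<otimes> m_inv G t) = X"
        using t X by (simp_all add: cj_def m_assoc c1 c2)
      have "t \<otimes> cj t X = X \<otimes> t" using t X by (simp add: cj_def m_assoc c1)
      then have "F (cj t X) = F X" by (rule F[OF t X cX])
      then show "(if cj t X \<in> K then mat_trace (\<rho> (cj t X)) else 0) * F (cj t X) =
          (if cj t X \<in> K then mat_trace (\<rho> (cj t X)) else 0) * F X" by simp
    qed
    also have "\<dots> = (\<Sum>Y\<in>K. mat_trace (\<rho> Y) * F Y)"
      by (rule sum.mono_neutral_cong_right) (use fin K in auto)
    finally show ?thesis .
  qed
  have "(\<Sum>X\<in>carrier G. mat_trace (induced_rep (mult G) ginv (carrier G) K \<rho> N X) * F X) =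
      (\<Sum>a<length ts. \<Sum>X\<in>carrier G. (if cj (ts ! a) X \<in> K then mat_trace (\<rho> (cj (ts ! a) X)) else 0) * F X)"
    unfolding trace sum_distrib_right by (rule sum.swap)
  also have "\<dots> = (\<Sum>a<length ts. \<Sum>Y\<in>K. mat_trace (\<rho> Y) * F Y)"
    by (rule sum.cong[OF refl]) (simp only: conj[OF tG] lessThan_iff)
  finally show "(\<Sum>X\<in>carrier G. mat_trace (induced_rep (mult G) ginv (carrier G) K \<rho> N X) * F X) =
      of_nat (length (left_transversal (mult G) ginv (carrier G) K)) * (\<Sum>Y\<in>K. mat_trace (\<rho> Y) * F Y)"
    by (simp add: ts_def)
qed

text \<open>Every cycle product is the identity matrix, of trace \<open>m\<close>, so each cycle
  contributes the same root of unity.\<close>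

lemma Lambda_sym:
  assumes "prime p" and "card (UNIV :: 'k::{field, finite} set) = p ^ d"
  shows "Lambda p d n m (\<sigma>, \<lambda>i. 1\<^sub>m m :: 'k mat) =
         exp (2 * pi * \<i> * of_nat (m * d) / of_nat p) ^ num_cycles n \<sigma>"
proof -
  have "path_product m \<sigma> (\<lambda>i. 1\<^sub>m m :: 'k mat) r i = 1\<^sub>m m" for r i
    by (induction r arbitrary: i) (auto simp: path_product_0 path_product_Suc)
  then have "cycle_product m \<sigma> (\<lambda>i. 1\<^sub>m m :: 'k mat) i = 1\<^sub>m m" for i
    by (simp add: cycle_product_def path_product_def)
  then show ?thesis
    by (simp add: Lambda_def num_cycles_def mat_trace_one add_char_of_nat[OF assms])
qed

theorem theorem7p3:
  fixes p d m n :: nat and H :: "'k::{field, finite} mat set" and x :: complex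
    and lam :: "nat list"
  assumes "prime p" and "d \<ge> 1" and "card (UNIV :: 'k set) = p ^ d"
    and "m \<ge> 1" and "is_GL_subgroup m H"
    and "n \<ge> 1" and "is_partition n lam"
  shows "W p d n m x (wreath n m H)
           (induced_rep (wr_mult n m) (wr_inv n m H) (wreath n m H) (sym_in_wreath n m)
              (\<lambda>X. specht_rep n lam (fst X)) (length (specht_basis n lam)))
           (dim_row (induced_rep (wr_mult n m) (wr_inv n m H) (wreath n m H) (sym_in_wreath n m)
              (\<lambda>X. specht_rep n lam (fst X)) (length (specht_basis n lam)) (wr_one m)))
         = content_poly lam (x * exp (2 * pi * \<i> * of_nat (m * d) / of_nat p))"
proof -
  note GL = assms(5)
  let ?G = "wreath_group n m H" and ?N = "length (specht_basis n lam)"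
  let ?T = "left_transversal (wr_mult n m) (wr_inv n m H) (wreath n m H) (sym_in_wreath n m)"
  let ?\<rho> = "\<lambda>X :: 'k wr_elem. specht_rep n lam (fst X)"
  let ?y = "x * exp (2 * pi * \<i> * of_nat (m * d) / of_nat p)"
  let ?I = "induced_rep (wr_mult n m) (wr_inv n m H) (wreath n m H) (sym_in_wreath n m) ?\<rho> ?N"
  let ?F = "\<lambda>X. psi n x (fst X) * Lambda p d n m X"
  note simps = wreath_group_simps[OF GL]
  have "H \<subseteq> carrier_mat m m" using GL by (simp add: is_GL_subgroup_def)
  then have finH: "finite H" by (rule finite_subset[OF _ finite_carrier_mat])
  have 1: "group ?G" by (rule group_wreath[OF GL])
  have 2: "finite (carrier ?G)" unfolding simps by (rule finite_wreath[OF GL finH])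
  have 3: "sym_in_wreath n m \<subseteq> carrier ?G" unfolding simps by (rule sym_in_wreath_subset[OF GL])
  have 4: "wr_inv n m H t = m_inv ?G t" if "t \<in> carrier ?G" for t
    using that unfolding simps by (rule wr_inv_eq[OF GL])
  have 5: "\<exists>ts. set ts \<subseteq> carrier ?G \<and> (\<forall>g\<in>carrier ?G.
     \<exists>!i. i < length ts \<and> monoid.mult ?G (wr_inv n m H (ts ! i)) g \<in> sym_in_wreath n m)"
    unfolding simps by (rule wreath_transversal[OF GL finH])
  have 6: "dim_row (?\<rho> X) = ?N" for X :: "'k wr_elem"
    by (simp add: specht_rep_def Let_def)
  have 7: "?F Y = ?F X" if "t \<in> carrier ?G" "X \<in> carrier ?G" "Y \<in> carrier ?G"
      "monoid.mult ?G t Y = monoid.mult ?G X t" for t X Y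
    using that unfolding simps
    by (simp only: psi_conj[OF GL that(1)[unfolded simps] that(4)[unfolded simps]]
      Lambda_conj[OF GL that(2)[unfolded simps] that(3)[unfolded simps] that(1)[unfolded simps]
        that(4)[unfolded simps]])
  note ind = induced_character_sum[of ?G "sym_in_wreath n m" "wr_inv n m H" ?\<rho> ?N ?F,
      OF 1 2 3 4 5 6 7, unfolded simps]
  have "(\<Sum>Y\<in>sym_in_wreath n m. mat_trace (?\<rho> Y) * ?F Y) =
      (\<Sum>\<sigma> | \<sigma> permutes {1..n}. mat_trace (specht_rep n lam \<sigma>) * ?y ^ num_cycles n \<sigma>)"
    by (rule sum.reindex_bij_witness[where i = "\<lambda>\<sigma>. (\<sigma>, \<lambda>i. 1\<^sub>m m)" and j = fst])
       (auto simp: sym_in_wreath_def psi_def Lambda_sym[OF assms(1,3)] power_mult_distrib)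
  also have "\<dots> = of_nat ?N * content_poly lam ?y"
    by (rule specht_character_cycle_sum[OF assms(7)])
  finally have sumK: "(\<Sum>Y\<in>sym_in_wreath n m. mat_trace (?\<rho> Y) * ?F Y) = of_nat ?N * content_poly lam ?y" .
  have "dim_row (?I (wr_one m)) = length ?T * ?N"
    by (simp add: induced_rep_def Let_def)
  then have "W p d n m x (wreath n m H) ?I (dim_row (?I (wr_one m))) =
      1 / of_nat (length ?T * ?N) * (\<Sum>X\<in>wreath n m H. mat_trace (?I X) * ?F X)"
    by (simp add: W_def mult.assoc)
  \<comment> \<open>The sum carries exactly the two factors of the dimension, the number of cosets
    and \<open>?N\<close>, and both are positive.\<close>
  also have "\<dots> = 1 / of_nat (length ?T * ?N) * (of_nat (length ?T) * (of_nat ?N * content_poly lam ?y))"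
    by (simp only: ind(1) sumK)
  also have "\<dots> = content_poly lam ?y"
    using ind(2) specht_dim_pos[OF assms(7)] by simp
  finally show ?thesis .
qed

end
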